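(* For $d\in\mathbb{N}$ and $C>0$, set $\mathcal{GB}_d^\ast(C):=\{f\in\mathcal{GB}_d(C): 0\leq f\leq 1\}$. Then there exist $\varepsilon^{(0)}=\varepsilon^{(0)}(d,C)>0$ and $C_0=C_0(d,C)>0$ such that for every $\varepsilon\in(0,\varepsilon^{(0)}]$ we have $$M_{\mathcal{GB}_d(C),L^1}(\varepsilon)\;\geq\; M_{\mathcal{GB}_d^\ast(C),L^1}(\varepsilon)\;\geq\; M_{B_d(C),L^1}(\varepsilon)\;\geq\; C_0\cdot\varepsilon^{-\frac{2d}{2+d}}\;=\;C_0\cdot\varepsilon^{-1/(\frac12+\frac1d)} .$$
   Context: $\mathcal{GB}_d(C)$ is the set of general Barron functions with constant $C$: all functions $f:[0,1]^d\to\mathbb{R}$ for which there exist a complex measure $\mu$ on $\mathbb{R}^d$ and some $c\in[-C,C]$ with $$f(x)=c+\int_{\mathbb{R}^d}\bigl(e^{2\pi i\langle x,\xi\rangle}-1\bigr)\,d\mu(\xi)\ \text{ for all }x\in[0,1]^d,\qquad \int_{\mathbb{R}^d}|\xi|\,d|\mu|(\xi)\leq C,$$ where $|\mu|$ is the total variation measure of $\mu$. $B_d(C)$ is the set of all functions $f:[0,1]^d\to[0,1]$ for which there exist a measurable $F:\mathbb{R}^d\to\mathbb{C}$ and some $c\in[-C,C]$ with $f(x)=c+\int_{\mathbb{R}^d}(e^{i\langle x,\xi\rangle}-1)F(\xi)\,d\xi$ for all $x\in[0,1]^d$ and $\int_{\mathbb{R}^d}|\xi|\,|F(\xi)|\,d\xi\leq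 C$. Packing entropy: for a nonempty subset $K$ of a metric space with metric $\mathrm{dist}$ and $\varepsilon>0$, an $\varepsilon$-packing set in $K$ is a set $N\subset K$ with $\mathrm{dist}(x_1,x_2)>\varepsilon$ for all distinct $x_1,x_2\in N$. $M_{K,\mathrm{dist}}(\varepsilon)$ is the natural logarithm of the maximal cardinality of an $\varepsilon$-packing set in $K$. The subscript $L^1$ refers to the metric induced by $\|\cdot\|_{L^1([0,1]^d)}$. *)

theory Defs
  imports "HOL-Analysis.Analysis"
begin

text \<open>
  A complex measure is a countably additive complex-valued set function on the sigma-algebra of
  \<open>M\<close> (only the sigma-algebra of \<open>M\<close> is used). Its values off \<open>sets M\<close> are irrelevant;
  \<open>\<mu> {} = 0\<close> follows, since a constant series converges only if it is zero.
\<close>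

definition complex_measure :: "'a measure \<Rightarrow> ('a set \<Rightarrow> complex) \<Rightarrow> bool" where
  "complex_measure M \<mu> \<longleftrightarrow>
     (\<forall>A :: nat \<Rightarrow> 'a set. range A \<subseteq> sets M \<longrightarrow> disjoint_family A \<longrightarrow>
        (\<lambda>n. \<mu> (A n)) sums \<mu> (\<Union>n. A n))"

definition total_variation :: "'a measure \<Rightarrow> ('a set \<Rightarrow> complex) \<Rightarrow> 'a measure" where
  "total_variation M \<mu> = measure_of (space M) (sets M)
     (\<lambda>E. SUP A \<in> {A :: nat \<Rightarrow> 'a set. range A \<subseteq> sets M \<and> disjoint_family A \<and> (\<Union>n. A n) = E}.
        \<Sum>n. ennreal (cmod (\<mu> (A n))))"

text \<open>
  The positive part \<open>\<nu>\<^sup>+\<close> of the Jordan decomposition of a finite signed measure \<open>\<nu>\<close>, that is,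
  \<open>\<nu>\<^sup>+ E = sup {\<nu> A | A \<subseteq> E}\<close>; the negative part is the positive part of \<open>- \<nu>\<close>. The function
  \<open>ennreal\<close> truncates negative values to 0, which does not change the supremum as \<open>\<nu> {} = 0\<close>.
\<close>

definition positive_variation :: "'a measure \<Rightarrow> ('a set \<Rightarrow> real) \<Rightarrow> 'a measure" where
  "positive_variation M \<nu> = measure_of (space M) (sets M)
     (\<lambda>E. SUP A \<in> {A \<in> sets M. A \<subseteq> E}. ennreal (\<nu> A))"

definition complex_measure_integral ::
    "'a measure \<Rightarrow> ('a set \<Rightarrow> complex) \<Rightarrow> ('a \<Rightarrow> complex) \<Rightarrow> complex" where
  "complex_measure_integral M \<mu> g =
     ((\<integral>x. g x \<partial>positive_variation M (\<lambda>A. Re (\<mu> A)))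
        - (\<integral>x. g x \<partial>positive_variation M (\<lambda>A. - Re (\<mu> A))))
     + \<i> * ((\<integral>x. g x \<partial>positive_variation M (\<lambda>A. Im (\<mu> A)))
        - (\<integral>x. g x \<partial>positive_variation M (\<lambda>A. - Im (\<mu> A))))"

abbreviation unit_cube :: "(real ^ 'n) set" where
  "unit_cube \<equiv> cbox 0 1"

text \<open>
  Functions on the cube \<open>[0,1]\<^sup>d\<close>, with \<open>d = CARD('n)\<close>, are extensional functions on \<open>real ^ 'n\<close>
  (equal to \<open>undefined\<close> off the cube), so that equality means equality on the cube.
\<close>

definition general_barron :: "real \<Rightarrow> (real ^ 'n \<Rightarrow> real) set" where
  "general_barron C = {f \<in> unit_cube \<rightarrow>\<^sub>E UNIV.
     \<exists>\<mu> c. complex_measure borel \<mu> \<and> c \<in> {- C..C} \<and>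
       (\<forall>x\<in>unit_cube. complex_of_real (f x) = complex_of_real c
          + complex_measure_integral borel \<mu>
              (\<lambda>\<xi>. exp (2 * complex_of_real pi * \<i> * complex_of_real (x \<bullet> \<xi>)) - 1)) \<and>
       (\<integral>\<^sup>+\<xi>. ennreal (norm \<xi>) \<partial>total_variation borel \<mu>) \<le> ennreal C}"

definition general_barron_star :: "real \<Rightarrow> (real ^ 'n \<Rightarrow> real) set" where
  "general_barron_star C = {f \<in> general_barron C. \<forall>x\<in>unit_cube. 0 \<le> f x \<and> f x \<le> 1}"

text \<open>
  \<open>F\<close> itself need not be integrable; the moment bound makes \<open>(e\<^sup>i\<^sup>\<langle>\<^sup>x\<^sup>,\<^sup>\<xi>\<^sup>\<rangle> - 1) F(\<xi>)\<close> integrable.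
\<close>

definition barron :: "real \<Rightarrow> (real ^ 'n \<Rightarrow> real) set" where
  "barron C = {f \<in> unit_cube \<rightarrow>\<^sub>E {0..1}.
     \<exists>(F :: real ^ 'n \<Rightarrow> complex) c. F \<in> borel_measurable borel \<and> c \<in> {- C..C} \<and>
       (\<forall>x\<in>unit_cube. complex_of_real (f x) = complex_of_real c
          + (\<integral>\<xi>. (exp (\<i> * complex_of_real (x \<bullet> \<xi>)) - 1) * F \<xi> \<partial>lborel)) \<and>
       (\<integral>\<^sup>+\<xi>. ennreal (norm \<xi> * cmod (F \<xi>)) \<partial>lborel) \<le> ennreal C}"

definition L1_dist :: "(real ^ 'n \<Rightarrow> real) \<Rightarrow> (real ^ 'n \<Rightarrow> real) \<Rightarrow> real" where
  "L1_dist f g = (LINT x:unit_cube|lborel. \<bar>f x - g x\<bar>)"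

definition packing_set :: "'a set \<Rightarrow> ('a \<Rightarrow> 'a \<Rightarrow> real) \<Rightarrow> real \<Rightarrow> 'a set \<Rightarrow> bool" where
  "packing_set K dst \<epsilon> N \<longleftrightarrow> N \<subseteq> K \<and> (\<forall>x\<in>N. \<forall>y\<in>N. x \<noteq> y \<longrightarrow> dst x y > \<epsilon>)"

text \<open>
  Subsets of packing sets are packing sets, so finite packing sets suffice; the value is \<open>\<infinity>\<close>
  exactly if there are packing sets of arbitrarily large cardinality.
\<close>

definition packing_entropy :: "'a set \<Rightarrow> ('a \<Rightarrow> 'a \<Rightarrow> real) \<Rightarrow> real \<Rightarrow> ereal" where
  "packing_entropy K dst \<epsilon> =
     (SUP N \<in> {N. packing_set K dst \<epsilon> N \<and> finite N \<and> N \<noteq> {}}. ereal (ln (real (card N))))"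

end

theory Submission
  imports Defs "HOL-Probability.Probability"
begin

text \<open>
  The second inequality would follow from an inclusion of sets if every density in the definition of \<open>barron\<close> were
  integrable at the origin. In general a Barron function is a uniform limit of functions in
  \<open>general_barron_star\<close>, which suffices as the distances in a finite packing exceed \<open>\<epsilon>\<close> strictly.

  For the lower bound, put a narrow Gaussian bump into each of the \<open>n = m ^ d\<close> cells of a grid on the
  cube and consider the \<open>2 ^ n\<close> sums of these bumps with signs. Up to scaling, the density of such a
  sum is a Gaussian times the exponential sum with the same signs. By orthogonality of random signs
  the latter has mean modulus at most \<open>sqrt n\<close>, so for at least half of the signs the function with
  amplitude \<open>const / (m * sqrt n)\<close> lies in \<open>barron C\<close>. A greedy choice among these gives
  exponentially many signs that differ pairwise in more than \<open>n / 8\<close> cells. As the bumps are almost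
  disjoint, the corresponding functions have \<open>L1\<close>-distance at least \<open>const / (m * sqrt n)\<close>.
\<close>

subsection \<open>Sign sums and Hamming packings\<close>

text \<open>The rate comes from three scalings. A bump of spatial width of order
  \<open>1 / m\<close> has frequencies of order \<open>m\<close>, so a typical sign sum has first
  moment of order \<open>m * sqrt n\<close>; this fixes the admissible amplitude. The triangle
  inequality would only give \<open>m * n\<close> and hence a worse rate, which is why the signs are
  chosen at random. One bump has mass of order \<open>1 / n\<close>, and two separated sign patterns
  differ in a fixed fraction of the \<open>n\<close> cells, so their distance has the order of the
  amplitude, \<open>m powr (- (1 + d / 2))\<close>. Equating this with \<open>\<epsilon>\<close>
  gives \<open>n\<close> of order \<open>\<epsilon> powr (- (2 * d / (2 + d)))\<close>. Gaussians
  make both the bump and its density explicit, at the price of overlapping tails. Moreover, the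
  factor \<open>exp ... - 1\<close> subtracts from each sum its value at 0, so differences of two
  functions carry an unknown constant. Testing against a bounded function of mean zero deals with
  both. Sign patterns are encoded as subsets, so that the Hamming distance is the cardinality of a
  symmetric difference.\<close>

definition sgn_of :: "'k set \<Rightarrow> 'k \<Rightarrow> real" where
  "sgn_of S k = (if k \<in> S then 1 else - 1)"

lemma sum_Pow_insert:
  fixes f :: "'k set \<Rightarrow> 'b::comm_monoid_add"
  assumes "finite K" "k \<notin> K"
  shows "(\<Sum>S\<in>Pow (insert k K). f S) = (\<Sum>S\<in>Pow K. f S + f (insert k S))"
proof -
  have "inj_on (insert k) (Pow K)"
    using assms(2) by (intro inj_onI) (metis PowD insert_ident subsetD)
  moreover have "Pow K \<inter> insert k ` Pow K = {}"
    using assms(2) by auto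
  ultimately show ?thesis
    unfolding Pow_insert using assms(1)
    by (subst sum.union_disjoint) (auto simp: sum.reindex sum.distrib)
qed

text \<open>Orthogonality of random signs in the form of the parallelogram law: in the induction the
  two signs of the new index are paired, and the cross terms cancel.\<close>

lemma sum_signs_norm_sq:
  fixes z :: "'k \<Rightarrow> 'b::real_inner"
  assumes "finite K"
  shows "(\<Sum>S\<in>Pow K. (norm (\<Sum>k\<in>K. sgn_of S k *\<^sub>R z k))\<^sup>2) = 2 ^ card K * (\<Sum>k\<in>K. (norm (z k))\<^sup>2)"
  using assms
proof (induction K)
  case (insert k K)
  define v where "v S = (\<Sum>k\<in>K. sgn_of S k *\<^sub>R z k)" for S
  have v: "v (insert k S) = v S" for S
    unfolding v_def using insert.hyps by (intro sum.cong) (auto simp: sgn_of_def)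
  have "(norm (- z k + v S))\<^sup>2 + (norm (z k + v S))\<^sup>2 = 2 * (norm (z k))\<^sup>2 + 2 * (norm (v S))\<^sup>2" for S
    by (simp add: power2_norm_eq_inner inner_simps inner_commute)
  moreover have "(\<Sum>l\<in>insert k K. sgn_of S l *\<^sub>R z l) = - z k + v S"
    and "(\<Sum>l\<in>insert k K. sgn_of (insert k S) l *\<^sub>R z l) = z k + v S" if "S \<in> Pow K" for S
    using that insert.hyps v by (auto simp: sgn_of_def v_def)
  ultimately have "(\<Sum>S\<in>Pow (insert k K). (norm (\<Sum>l\<in>insert k K. sgn_of S l *\<^sub>R z l))\<^sup>2)
    = (\<Sum>S\<in>Pow K. 2 * (norm (z k))\<^sup>2 + 2 * (norm (v S))\<^sup>2)"
    unfolding sum_Pow_insert[OF insert.hyps] by (intro sum.cong refl) simp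
  also have "\<dots> = 2 ^ card (insert k K) * (\<Sum>k\<in>insert k K. (norm (z k))\<^sup>2)"
    using insert by (simp add: v_def sum.distrib card_Pow sum_distrib_left[symmetric] algebra_simps)
  finally show ?case .
qed simp

text \<open>Cauchy-Schwarz over all \<open>2 ^ card K\<close> sign patterns passes from the mean
  square to the mean norm.\<close>

lemma sum_signs_norm_le:
  fixes z :: "'k \<Rightarrow> 'b::real_inner"
  assumes "finite K" and "\<And>k. k \<in> K \<Longrightarrow> norm (z k) \<le> 1"
  shows "(\<Sum>S\<in>Pow K. norm (\<Sum>k\<in>K. sgn_of S k *\<^sub>R z k)) \<le> 2 ^ card K * sqrt (card K)"
proof (rule power2_le_imp_le)
  let ?v = "\<lambda>S. \<Sum>k\<in>K. sgn_of S k *\<^sub>R z k"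
  have "(\<Sum>S\<in>Pow K. 1 * norm (?v S))\<^sup>2 \<le> (\<Sum>S\<in>Pow K. 1\<^sup>2) * (\<Sum>S\<in>Pow K. (norm (?v S))\<^sup>2)"
    by (rule Cauchy_Schwarz_ineq_sum)
  also have "\<dots> = 2 ^ card K * (2 ^ card K * (\<Sum>k\<in>K. (norm (z k))\<^sup>2))"
    using assms(1) by (simp add: sum_signs_norm_sq card_Pow)
  also have "(\<Sum>k\<in>K. (norm (z k))\<^sup>2) \<le> (\<Sum>k\<in>K. 1)"
    using assms(2) by (intro sum_mono) (simp add: power_le_one)
  finally show "(\<Sum>S\<in>Pow K. norm (?v S))\<^sup>2 \<le> (2 ^ card K * sqrt (card K))\<^sup>2"
    by (simp add: power_mult_distrib) (simp add: power2_eq_square mult_ac)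
qed simp

text \<open>Markov's inequality: values above twice the mean bound \<open>a\<close> occur on at most
  half of \<open>X\<close>.\<close>

lemma card_le_twice_average:
  fixes g :: "'s \<Rightarrow> real" and a :: real
  assumes "finite X" and "\<And>S. S \<in> X \<Longrightarrow> 0 \<le> g S" and "(\<Sum>S\<in>X. g S) \<le> card X * a" and "0 < a"
  shows "card X \<le> 2 * card {S \<in> X. g S \<le> 2 * a}"
proof -
  let ?B = "{S \<in> X. \<not> g S \<le> 2 * a}"
  have "card ?B * (2 * a) = (\<Sum>S\<in>?B. 2 * a)" by simp
  also have "\<dots> \<le> (\<Sum>S\<in>?B. g S)" by (intro sum_mono) auto
  also have "\<dots> \<le> (\<Sum>S\<in>X. g S)" using assms by (intro sum_mono2) auto
  finally have "card ?B * (2 * a) \<le> card X * a" using assms by linarith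
  then have "2 * card ?B \<le> card X"
    using assms(4) by (simp add: mult.assoc[symmetric])
  moreover have "card X = card {S \<in> X. g S \<le> 2 * a} + card ?B"
    using assms(1) by (subst card_Un_disjoint[symmetric]) (auto intro!: arg_cong[of _ _ card])
  ultimately show ?thesis by simp
qed

text \<open>Exponential Markov inequality: the weight \<open>2 powr (n / 8 - card U)\<close> is at least 1 on the ball.\<close>

lemma card_hamming_ball_le:
  assumes "finite K"
  shows "real (card {U \<in> Pow K. 8 * card U \<le> card K}) \<le> (2 powr (1 / 8) * (3 / 2)) ^ card K"
proof -
  let ?n = "real (card K)"
  have "real (card {U \<in> Pow K. 8 * card U \<le> card K}) = (\<Sum>U | U \<in> Pow K \<and> 8 * card U \<le> card K. 1)"
    by simp
  also have "\<dots> \<le> (\<Sum>U | U \<in> Pow K \<and> 8 * card U \<le> card K. 2 powr (?n / 8) * (1 / 2) ^ card U)"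
  proof (rule sum_mono)
    fix U assume "U \<in> {U. U \<in> Pow K \<and> 8 * card U \<le> card K}"
    then have "real (card U) \<le> ?n / 8" by simp
    then have "2 powr real (card U) \<le> 2 powr (?n / 8)" by simp
    then show "1 \<le> 2 powr (?n / 8) * (1 / 2) ^ card U"
      by (simp add: powr_realpow field_simps)
  qed
  also have "\<dots> \<le> (\<Sum>U\<in>Pow K. 2 powr (?n / 8) * (1 / 2) ^ card U)"
    using assms by (intro sum_mono2) auto
  \<comment> \<open>Binomial theorem: expanding the product of the factors \<open>1 / 2 + 1\<close>
    over \<open>K\<close> yields one term \<open>(1 / 2) ^ card U\<close> for each subset
    \<open>U\<close>.\<close>
  also have "\<dots> = 2 powr (?n / 8) * (3 / 2) ^ card K"
    using prod_add[OF assms, of "\<lambda>_. 1 / 2 :: real" "\<lambda>_. 1"] by (simp add: sum_distrib_left)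
  also have "\<dots> = (2 powr (1 / 8) * (3 / 2)) ^ card K"
    by (simp add: power_mult_distrib powr_power del: times_divide_eq_right) simp
  finally show ?thesis .
qed

text \<open>Makes the base of the ball estimate at most \<open>11 / 10 * (3 / 2) = 33 / 20\<close>.
  That this is below 2 is what leaves exponentially many balls in a cover of half of all sign
  patterns.\<close>

lemma two_powr_eighth: "(2::real) powr (1 / 8) \<le> 11 / 10"
proof -
  have "((2::real) powr (1 / 8)) ^ 8 \<le> (11 / 10) ^ 8"
    by (subst powr_power) (simp_all add: power_divide)
  then show ?thesis by (rule power_mono_iff[THEN iffD1, rotated -1]) auto
qed

text \<open>A maximal separated subset covers \<open>G\<close> by Hamming balls.\<close>

lemma exists_separated_family:
  assumes K: "finite K" and G: "G \<subseteq> Pow K"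
  obtains P where "P \<subseteq> G" and "\<And>S T. S \<in> P \<Longrightarrow> T \<in> P \<Longrightarrow> S \<noteq> T \<Longrightarrow> card K < 8 * card (sym_diff S T)"
    and "real (card G) \<le> real (card P) * (33 / 20) ^ card K"
proof -
  define sep where "sep P \<longleftrightarrow> P \<subseteq> G \<and> (\<forall>S\<in>P. \<forall>T\<in>P. S \<noteq> T \<longrightarrow> card K < 8 * card (sym_diff S T))" for P
  have fG: "finite G" using assms finite_subset by blast
  have "finite {P. sep P}"
    by (rule finite_subset[of _ "Pow G"]) (use fG in \<open>auto simp: sep_def\<close>)
  moreover have "sep {}" by (simp add: sep_def)
  ultimately obtain P where P: "sep P" and max: "\<And>Q. sep Q \<Longrightarrow> P \<subseteq> Q \<Longrightarrow> P = Q"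
    using finite_has_maximal[of "{P. sep P}"] by (metis (mono_tags, lifting) empty_iff mem_Collect_eq)
  let ?B = "{U \<in> Pow K. 8 * card U \<le> card K}"
  have "G \<subseteq> (\<Union>S\<in>P. (\<lambda>U. sym_diff S U) ` ?B)"
  proof
    fix T assume T: "T \<in> G"
    have "\<exists>S\<in>P. 8 * card (sym_diff S T) \<le> card K"
    proof (rule ccontr)
      assume *: "\<not> ?thesis"
      then have "sep (insert T P)"
        using P T by (auto simp: sep_def not_le Un_commute)
      then have "T \<in> P" using max by blast
      then show False using * by auto
    qed
    then obtain S where S: "S \<in> P" "8 * card (sym_diff S T) \<le> card K" by auto
    \<comment> \<open>Symmetric difference with \<open>S\<close> is an involution, so the Hamming
      ball around \<open>S\<close> is the image of the ball around the empty set.\<close>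
    moreover have "T = sym_diff S (sym_diff S T)" by auto
    moreover have "sym_diff S T \<subseteq> K" using S(1) T P G by (auto simp: sep_def)
    ultimately show "T \<in> (\<Union>S\<in>P. (\<lambda>U. sym_diff S U) ` ?B)" by blast
  qed
  moreover have fP: "finite P" using P fG by (auto simp: sep_def intro: finite_subset)
  ultimately have "card G \<le> card (\<Union>S\<in>P. (\<lambda>U. sym_diff S U) ` ?B)"
    using K by (intro card_mono) auto
  also have "\<dots> \<le> (\<Sum>S\<in>P. card ((\<lambda>U. sym_diff S U) ` ?B))"
    using fP by (rule card_UN_le)
  also have "\<dots> \<le> (\<Sum>S\<in>P. card ?B)"
    using K by (intro sum_mono card_image_le) auto
  finally have "card G \<le> card P * card ?B" by simp
  then have "real (card G) \<le> real (card P) * real (card ?B)"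
    by (metis of_nat_le_iff of_nat_mult)
  also have "\<dots> \<le> real (card P) * (33 / 20) ^ card K"
    using card_hamming_ball_le[OF K] two_powr_eighth
    by (intro mult_left_mono order_trans[OF card_hamming_ball_le[OF K]] power_mono) auto
  finally show ?thesis using that[of P] P by (auto simp: sep_def)
qed

subsection \<open>Gaussian integrals\<close>

text \<open>Fubini for product functions, since \<open>lborel\<close> is the image of the product of
  one-dimensional Lebesgue measures. The general value type covers the real moments as well as the
  complex Fourier integrals below.\<close>

lemma integral_lborel_prod:
  fixes f :: "'a::euclidean_space \<Rightarrow> real \<Rightarrow> 'b::{real_normed_field,banach,second_countable_topology}"
  assumes "\<And>b. b \<in> Basis \<Longrightarrow> integrable lborel (f b)"
  shows "integrable lborel (\<lambda>x::'a. \<Prod>b\<in>Basis. f b (x \<bullet> b))"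
    and "(\<integral>x. (\<Prod>b\<in>Basis. f b (x \<bullet> b)) \<partial>lborel) = (\<Prod>b\<in>Basis. \<integral>t. f b t \<partial>lborel)"
proof -
  interpret product_sigma_finite "\<lambda>_::'a. lborel :: real measure" ..
  have [measurable]: "f b \<in> borel_measurable borel" if "b \<in> Basis" for b
    using borel_measurable_integrable[OF assms[OF that]] by simp
  have eq: "(\<Prod>b\<in>Basis. f b ((\<Sum>c\<in>Basis. x c *\<^sub>R c) \<bullet> b)) = (\<Prod>b\<in>Basis. f b (x b))" for x
    by (intro prod.cong refl) simp
  show "integrable lborel (\<lambda>x::'a. \<Prod>b\<in>Basis. f b (x \<bullet> b))"
    unfolding lborel_eq[where 'a='a]
    by (subst integrable_distr_eq) (auto simp: eq intro!: product_integrable_prod assms)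
  show "(\<integral>x. (\<Prod>b\<in>Basis. f b (x \<bullet> b)) \<partial>lborel) = (\<Prod>b\<in>Basis. \<integral>t. f b t \<partial>lborel)"
    unfolding lborel_eq[where 'a='a]
    by (subst integral_distr) (auto simp: eq intro!: product_integral_prod assms)
qed

text \<open>The centred normal density with independent coordinates of standard deviation
  \<open>\<sigma>\<close>. The product form reduces moments and Fourier transform to dimension
  one.\<close>

definition gauss :: "real \<Rightarrow> 'a::euclidean_space \<Rightarrow> real" where
  "gauss \<sigma> x = (\<Prod>b\<in>Basis. normal_density 0 \<sigma> (x \<bullet> b))"

text \<open>Used throughout to multiply pointwise estimates by the Gaussian weight.\<close>

lemma gauss_nonneg: "0 \<le> gauss \<sigma> x"
  unfolding gauss_def by (intro prod_nonneg) auto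

text \<open>The closed form serves to recognise the Fourier transform of
  \<open>gauss \<sigma>\<close> as a multiple of \<open>gauss (1 / \<sigma>)\<close>.\<close>

lemma gauss_eq:
  fixes x :: "'a::euclidean_space"
  assumes "0 < \<sigma>"
  shows "gauss \<sigma> x = exp (- (norm x)\<^sup>2 / (2 * \<sigma>\<^sup>2)) / (sqrt (2 * pi) * \<sigma>) ^ DIM('a)"
proof -
  have "(\<Sum>b\<in>Basis. - (x \<bullet> b)\<^sup>2 / (2 * \<sigma>\<^sup>2)) = - (norm x)\<^sup>2 / (2 * \<sigma>\<^sup>2)"
    unfolding power2_norm_eq_inner euclidean_inner[of x x]
    by (simp add: sum_divide_distrib[symmetric] sum_negf power2_eq_square)
  then show ?thesis
    using assms unfolding gauss_def normal_density_def
    by (simp add: prod_dividef exp_sum[symmetric] real_sqrt_mult power_mult_distrib prod.distrib)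
qed

lemma borel_measurable_gauss [measurable]: "gauss \<sigma> \<in> borel_measurable borel"
  unfolding gauss_def by measurable

lemma integrable_gauss: "0 < \<sigma> \<Longrightarrow> integrable lborel (gauss \<sigma> :: 'a::euclidean_space \<Rightarrow> real)"
  unfolding gauss_def[abs_def] by (rule integral_lborel_prod) auto

lemma integral_gauss: "0 < \<sigma> \<Longrightarrow> (\<integral>x. gauss \<sigma> (x :: 'a::euclidean_space) \<partial>lborel) = 1"
  unfolding gauss_def by (subst integral_lborel_prod) auto

text \<open>Only the factor of the coordinate \<open>c\<close> carries the weight \<open>h\<close>;
  all other factors integrate to 1.\<close>

lemma gauss_coordinate_moment:
  fixes c :: "'a::euclidean_space" and h :: "real \<Rightarrow> real"
  assumes "0 < \<sigma>" and c: "c \<in> Basis" and h: "has_bochner_integral lborel (\<lambda>t. normal_density 0 \<sigma> t * h t) I"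
  shows "has_bochner_integral lborel (\<lambda>x. h (x \<bullet> c) * gauss \<sigma> x) I"
proof -
  let ?f = "\<lambda>b t. normal_density 0 \<sigma> t * (if b = c then h t else 1)"
  have eq: "(\<Prod>b\<in>Basis. ?f b (x \<bullet> b)) = h (x \<bullet> c) * gauss \<sigma> x" for x :: 'a
    unfolding gauss_def prod.distrib using c by (simp add: prod.delta)
  have int: "integrable lborel (?f b)" for b
    using h assms(1) by (cases "b = c") (auto simp: has_bochner_integral_iff)
  have "(\<Prod>b\<in>Basis. \<integral>t. ?f b t \<partial>lborel) = (\<Prod>b\<in>Basis. if b = c then I else 1)"
    using h assms(1) by (intro prod.cong refl) (auto simp: has_bochner_integral_iff)
  also have "\<dots> = I" using c by simp
  finally show ?thesis
    using integral_lborel_prod[of ?f, OF int] by (simp add: has_bochner_integral_iff eq)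
qed

text \<open>The Euclidean norm is bounded by the sum of the coordinate moduli, each of which has
  mean \<open>\<sigma> * sqrt (2 / pi)\<close>. This is the source of the Barron moment of a
  bump.\<close>

lemma gauss_first_moment:
  assumes "0 < \<sigma>"
  shows "integrable lborel (\<lambda>x::'a::euclidean_space. norm x * gauss \<sigma> x)"
    and "(\<integral>x. norm x * gauss \<sigma> (x :: 'a) \<partial>lborel) \<le> real DIM('a) * \<sigma>"
proof -
  let ?I = "\<sigma> * sqrt (2 / pi)"
  have "has_bochner_integral lborel (\<lambda>t. normal_density 0 \<sigma> t * \<bar>t\<bar>) ?I"
    using normal_moment_abs_odd[OF assms, of 0 0] by simp
  then have "has_bochner_integral lborel (\<lambda>x::'a. \<bar>x \<bullet> c\<bar> * gauss \<sigma> x) ?I" if "c \<in> Basis" for c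
    using gauss_coordinate_moment[OF assms that] by fast
  then have B: "has_bochner_integral lborel (\<lambda>x::'a. \<Sum>c\<in>Basis. \<bar>x \<bullet> c\<bar> * gauss \<sigma> x) (\<Sum>c\<in>(Basis::'a set). ?I)"
    by (intro has_bochner_integral_sum)
  have le: "norm x * gauss \<sigma> x \<le> (\<Sum>c\<in>Basis. \<bar>x \<bullet> c\<bar> * gauss \<sigma> x)" for x :: 'a
    unfolding sum_distrib_right[symmetric] by (intro mult_right_mono norm_le_l1 gauss_nonneg)
  show int: "integrable lborel (\<lambda>x::'a. norm x * gauss \<sigma> x)"
    by (rule Bochner_Integration.integrable_bound[OF integrable.intros[OF B]])
      (use le gauss_nonneg in \<open>auto intro!: AE_I2 order_trans[OF _ order_trans[OF le abs_ge_self]] simp: abs_mult gauss_nonneg\<close>)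
  have "(\<integral>x. norm x * gauss \<sigma> (x :: 'a) \<partial>lborel) \<le> (\<Sum>c\<in>(Basis::'a set). ?I)"
    using integral_mono[OF int integrable.intros[OF B] le]
      has_bochner_integral_integral_eq[OF B] by simp
  also have "\<dots> \<le> real DIM('a) * \<sigma>"
    using assms pi_gt3 by (simp add: mult_le_cancel_left1)
  finally show "(\<integral>x. norm x * gauss \<sigma> (x :: 'a) \<partial>lborel) \<le> real DIM('a) * \<sigma>" .
qed

lemma gauss_second_moment:
  assumes "0 < \<sigma>"
  shows "has_bochner_integral lborel (\<lambda>x::'a::euclidean_space. (norm x)\<^sup>2 * gauss \<sigma> x) (real DIM('a) * \<sigma>\<^sup>2)"
proof -
  have "has_bochner_integral lborel (\<lambda>t. normal_density 0 \<sigma> t * t\<^sup>2) (\<sigma>\<^sup>2)"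
    using normal_moment_even[OF assms, of 0 1] by (simp add: fact_numeral)
  then have "has_bochner_integral lborel (\<lambda>x::'a. (x \<bullet> c)\<^sup>2 * gauss \<sigma> x) (\<sigma>\<^sup>2)" if "c \<in> Basis" for c
    using gauss_coordinate_moment[OF assms that] by fast
  then have "has_bochner_integral lborel (\<lambda>x::'a. \<Sum>c\<in>Basis. (x \<bullet> c)\<^sup>2 * gauss \<sigma> x) (\<Sum>c\<in>(Basis::'a set). \<sigma>\<^sup>2)"
    by (intro has_bochner_integral_sum)
  moreover have "(\<Sum>c\<in>Basis. (x \<bullet> c)\<^sup>2 * gauss \<sigma> x) = (norm x)\<^sup>2 * gauss \<sigma> x" for x :: 'a
    unfolding sum_distrib_right[symmetric]
    by (subst power2_norm_eq_inner, subst euclidean_inner) (simp add: power2_eq_square)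
  ultimately show ?thesis by simp
qed

text \<open>The characteristic function of the standard normal law, rescaled by substituting
  \<open>t / \<sigma>\<close>.\<close>

lemma fourier_normal_density:
  assumes "0 < \<sigma>"
  shows "integrable lborel (\<lambda>t. exp (\<i> * complex_of_real (t * s)) * complex_of_real (normal_density 0 \<sigma> t))"
    and "(\<integral>t. exp (\<i> * complex_of_real (t * s)) * complex_of_real (normal_density 0 \<sigma> t) \<partial>lborel)
       = complex_of_real (exp (- (\<sigma>\<^sup>2 * s\<^sup>2) / 2))"
proof -
  show "integrable lborel (\<lambda>t. exp (\<i> * complex_of_real (t * s)) * complex_of_real (normal_density 0 \<sigma> t))"
    by (rule Bochner_Integration.integrable_bound[OF integrable_normal_density[OF assms, of 0]])
      (auto simp: norm_mult)
  have "complex_of_real (exp (- (\<sigma>\<^sup>2 * s\<^sup>2) / 2)) = char std_normal_distribution (\<sigma> * s)"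
    by (simp add: char_std_normal_distribution power_mult_distrib)
  also have "\<dots> = (\<integral>t. std_normal_density t *\<^sub>R iexp (\<sigma> * s * t) \<partial>lborel)"
    unfolding char_def by (subst integral_density) (auto intro: normal_density_nonneg)
  also have "\<dots> = (\<integral>t. \<bar>1 / \<sigma>\<bar> *\<^sub>R (std_normal_density (1 / \<sigma> * t) *\<^sub>R iexp (\<sigma> * s * (1 / \<sigma> * t))) \<partial>lborel)"
    using assms by (subst lborel_integral_real_affine[where c = "1 / \<sigma>" and t = 0])
      (simp_all del: scaleR_scaleR times_divide_eq_left times_divide_eq_right)
  also have "\<dots> = (\<integral>t. exp (\<i> * complex_of_real (t * s)) * complex_of_real (normal_density 0 \<sigma> t) \<partial>lborel)"
  proof (intro Bochner_Integration.integral_cong refl)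
    fix t
    have "\<bar>1 / \<sigma>\<bar> * std_normal_density (1 / \<sigma> * t) = normal_density 0 \<sigma> t"
      using assms by (simp add: normal_density_def real_sqrt_mult power_mult_distrib power_divide mult_ac)
    moreover have "\<sigma> * s * (1 / \<sigma> * t) = t * s" using assms by simp
    ultimately show "\<bar>1 / \<sigma>\<bar> *\<^sub>R (std_normal_density (1 / \<sigma> * t) *\<^sub>R iexp (\<sigma> * s * (1 / \<sigma> * t)))
      = exp (\<i> * complex_of_real (t * s)) * complex_of_real (normal_density 0 \<sigma> t)"
      by (metis scaleR_scaleR scaleR_conv_of_real mult.commute)
  qed
  finally show "(\<integral>t. exp (\<i> * complex_of_real (t * s)) * complex_of_real (normal_density 0 \<sigma> t) \<partial>lborel)
       = complex_of_real (exp (- (\<sigma>\<^sup>2 * s\<^sup>2) / 2))" ..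
qed

lemma fourier_gauss:
  fixes x :: "'a::euclidean_space"
  assumes "0 < \<sigma>"
  shows "integrable lborel (\<lambda>\<xi>. exp (\<i> * complex_of_real (x \<bullet> \<xi>)) * complex_of_real (gauss \<sigma> \<xi>))"
    and "(\<integral>\<xi>. exp (\<i> * complex_of_real (x \<bullet> \<xi>)) * complex_of_real (gauss \<sigma> \<xi>) \<partial>lborel)
       = complex_of_real (exp (- (\<sigma>\<^sup>2 * (norm x)\<^sup>2) / 2))"
proof -
  let ?f = "\<lambda>b t. exp (\<i> * complex_of_real (t * (x \<bullet> b))) * complex_of_real (normal_density 0 \<sigma> t)"
  have eq: "(\<Prod>b\<in>Basis. ?f b (\<xi> \<bullet> b)) = exp (\<i> * complex_of_real (x \<bullet> \<xi>)) * complex_of_real (gauss \<sigma> \<xi>)" for \<xi> :: 'a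
    unfolding gauss_def prod.distrib
    by (subst euclidean_inner[of x \<xi>]) (simp add: exp_sum[symmetric] sum_distrib_left mult_ac)
  note int = fourier_normal_density[OF assms]
  show "integrable lborel (\<lambda>\<xi>. exp (\<i> * complex_of_real (x \<bullet> \<xi>)) * complex_of_real (gauss \<sigma> \<xi>))"
    using integral_lborel_prod(1)[of ?f, OF int(1)] unfolding eq .
  have "(\<integral>\<xi>. exp (\<i> * complex_of_real (x \<bullet> \<xi>)) * complex_of_real (gauss \<sigma> \<xi>) \<partial>lborel)
    = (\<Prod>b\<in>Basis. complex_of_real (exp (- (\<sigma>\<^sup>2 * (x \<bullet> b)\<^sup>2) / 2)))"
    using integral_lborel_prod(2)[of ?f, OF int(1)] unfolding eq int(2) .
  also have "\<dots> = complex_of_real (exp (- (\<sigma>\<^sup>2 * (norm x)\<^sup>2) / 2))"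
    unfolding of_real_prod[symmetric] 
    by (subst power2_norm_eq_inner, subst euclidean_inner)
      (simp add: exp_sum[symmetric] sum_divide_distrib[symmetric] sum_negf sum_distrib_left power2_eq_square)
  finally show "(\<integral>\<xi>. exp (\<i> * complex_of_real (x \<bullet> \<xi>)) * complex_of_real (gauss \<sigma> \<xi>) \<partial>lborel)
       = complex_of_real (exp (- (\<sigma>\<^sup>2 * (norm x)\<^sup>2) / 2))" .
qed

subsection \<open>Complex measures with a density\<close>

text \<open>The set where \<open>r\<close> is positive is a Hahn set, so the supremum over the
  subsets of \<open>E\<close> is attained at its intersection with \<open>E\<close>. The measure
  \<open>N\<close> carries the integration, whereas \<open>M\<close> only supplies the
  sigma-algebra.\<close>

lemma positive_variation_eq_density:
  fixes r :: "'a \<Rightarrow> real"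
  assumes sets: "sets N = sets M" and r: "integrable N r"
    and \<nu>: "\<And>A. A \<in> sets M \<Longrightarrow> \<nu> A = (LINT x:A|N. r x)"
  shows "positive_variation M \<nu> = density N (\<lambda>x. ennreal (r x))"
proof -
  let ?D = "density N (\<lambda>x. ennreal (r x))"
  have [measurable]: "r \<in> borel_measurable N" using r by simp
  have space: "space N = space M" using sets by (rule sets_eq_imp_space_eq)
  have eq: "(SUP A \<in> {A \<in> sets M. A \<subseteq> E}. ennreal (\<nu> A)) = emeasure ?D E" if E: "E \<in> sets M" for E
  proof (rule antisym)
    have mE [measurable]: "E \<in> sets N" using E sets by simp
    show "(SUP A \<in> {A \<in> sets M. A \<subseteq> E}. ennreal (\<nu> A)) \<le> emeasure ?D E"
    proof (rule SUP_least)
      fix A assume "A \<in> {A \<in> sets M. A \<subseteq> E}"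
      then have A: "A \<in> sets M" "A \<subseteq> E" and [measurable]: "A \<in> sets N" using sets by auto
      have "\<nu> A \<le> (\<integral>x. indicator A x * max 0 (r x) \<partial>N)"
        using integrable_mult_indicator[of A N "\<lambda>x. max 0 (r x)"] integrable_mult_indicator[of A N r] r
        unfolding \<nu>[OF A(1)] set_lebesgue_integral_def
        by (intro integral_mono) (auto simp: mult_left_mono)
      then have "ennreal (\<nu> A) \<le> ennreal (\<integral>x. indicator A x * max 0 (r x) \<partial>N)"
        by (rule ennreal_leI)
      also have "\<dots> = (\<integral>\<^sup>+x. ennreal (indicator A x * max 0 (r x)) \<partial>N)"
        using integrable_mult_indicator[of A N "\<lambda>x. max 0 (r x)"] r
        by (intro nn_integral_eq_integral[symmetric]) auto
      also have "\<dots> \<le> (\<integral>\<^sup>+x. ennreal (r x) * indicator E x \<partial>N)"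
        using A(2) by (intro nn_integral_mono) (auto simp: indicator_def max_def ennreal_neg)
      also have "\<dots> = emeasure ?D E" by (simp add: emeasure_density)
      finally show "ennreal (\<nu> A) \<le> emeasure ?D E" .
    qed
    let ?A = "{x \<in> space N. 0 < r x} \<inter> E"
    have A: "?A \<in> sets N" by measurable
    have "emeasure ?D E = (\<integral>\<^sup>+x. ennreal (r x) * indicator E x \<partial>N)" by (simp add: emeasure_density)
    also have "\<dots> = (\<integral>\<^sup>+x. ennreal (indicator ?A x *\<^sub>R r x) \<partial>N)"
      by (intro nn_integral_cong) (auto simp: indicator_def ennreal_neg)
    also have "\<dots> = ennreal (\<nu> ?A)"
      using A sets integrable_mult_indicator[OF A r] unfolding \<nu>[OF A[unfolded sets]] set_lebesgue_integral_def
      by (intro nn_integral_eq_integral) (auto simp: indicator_def)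
    also have "\<dots> \<le> (SUP A \<in> {A \<in> sets M. A \<subseteq> E}. ennreal (\<nu> A))"
      using A sets by (intro SUP_upper) auto
    finally show "emeasure ?D E \<le> (SUP A \<in> {A \<in> sets M. A \<subseteq> E}. ennreal (\<nu> A))" .
  qed
  have "positive_variation M \<nu> = measure_of (space M) (sets M) (emeasure ?D)"
    unfolding positive_variation_def
    by (rule measure_of_eq[OF sets.space_closed]) (simp add: eq sets.sigma_sets_eq)
  also have "\<dots> = ?D"
    using measure_of_of_measure[of ?D] by (simp add: sets space)
  finally show ?thesis .
qed

text \<open>Countable additivity is continuity of the set integral along the increasing unions of
  the first \<open>n\<close> sets.\<close>

lemma complex_measure_density:
  assumes sets: "sets N = sets M" and g: "integrable N g"
  shows "complex_measure M (\<lambda>A. LINT x:A|N. g x)"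
  unfolding complex_measure_def
proof (intro allI impI)
  fix A :: "nat \<Rightarrow> 'a set" assume A: "range A \<subseteq> sets M" and disj: "disjoint_family A"
  have mA [measurable]: "A n \<in> sets N" for n using A sets by auto
  have int: "set_integrable N X g" if "X \<in> sets N" for X
    unfolding set_integrable_def using that g by (intro integrable_mult_indicator)
  let ?B = "\<lambda>n. \<Union>i<n. A i"
  have "(\<lambda>n. LINT x:?B n|N. g x) \<longlonglongrightarrow> (LINT x:(\<Union>n. ?B n)|N. g x)"
    by (intro set_integral_cont_up int incseq_SucI) (auto simp: lessThan_Suc)
  moreover have "(\<Union>n. ?B n) = (\<Union>n. A n)" by auto
  moreover have "(LINT x:?B n|N. g x) = (\<Sum>i<n. LINT x:A i|N. g x)" for n
    using disj by (intro set_integral_finite_Union) (auto simp: disjoint_family_on_def int)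
  ultimately show "(\<lambda>n. LINT x:A n|N. g x) sums (LINT x:(\<Union>n. A n)|N. g x)"
    unfolding sums_def by simp
qed

text \<open>The four Jordan parts have the positive and negative parts of \<open>Re (g x)\<close>
  and \<open>Im (g x)\<close> as densities. As \<open>max 0 r - max 0 (- r) = r\<close>, their
  integrals recombine; boundedness of \<open>h\<close> keeps every piece integrable.\<close>

lemma complex_measure_integral_density:
  assumes sets: "sets N = sets M" and g: "integrable N g"
    and h [measurable]: "h \<in> borel_measurable N" and bound: "\<And>x. cmod (h x) \<le> B"
  shows "complex_measure_integral M (\<lambda>A. LINT x:A|N. g x) h = (\<integral>x. h x * g x \<partial>N)"
proof -
  have [measurable]: "g \<in> borel_measurable N" using g by simp
  have eqs: "Re (LINT x:A|N. g x) = (LINT x:A|N. Re (g x))" "Im (LINT x:A|N. g x) = (LINT x:A|N. Im (g x))"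
    "- (LINT x:A|N. Re (g x)) = (LINT x:A|N. - Re (g x))" "- (LINT x:A|N. Im (g x)) = (LINT x:A|N. - Im (g x))"
    if "A \<in> sets M" for A
    using that sets integrable_mult_indicator[of A N g] g
    by (simp_all add: set_lebesgue_integral_def flip: integral_Re integral_Im)
  have dens: "(\<integral>x. h x \<partial>density N (\<lambda>x. ennreal (r x))) = (\<integral>x. max 0 (r x) *\<^sub>R h x \<partial>N)"
    if [measurable]: "r \<in> borel_measurable N" for r
    using integral_density[of h N "\<lambda>x. max 0 (r x)"] by (simp add: ennreal_max_0')
  have int: "integrable N (\<lambda>x. max 0 (r x) *\<^sub>R h x)" if "integrable N r" for r
  proof (rule Bochner_Integration.integrable_bound[OF integrable_mult_left[OF integrable_norm[OF that]]])
    show "AE x in N. norm (max 0 (r x) *\<^sub>R h x) \<le> norm (norm (r x) * B)"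
    proof (rule AE_I2)
      fix x
      have "norm (max 0 (r x) *\<^sub>R h x) \<le> \<bar>r x\<bar> * B"
        using mult_mono[OF _ bound[of x], of "max 0 (r x)" "\<bar>r x\<bar>"] by simp
      then show "norm (max 0 (r x) *\<^sub>R h x) \<le> norm (norm (r x) * B)" by simp
    qed
  qed (use that in measurable)
  have split: "(\<integral>x. max 0 (r x) *\<^sub>R h x \<partial>N) - (\<integral>x. max 0 (- r x) *\<^sub>R h x \<partial>N) = (\<integral>x. of_real (r x) * h x \<partial>N)"
    if "integrable N r" for r
  proof -
    have "integrable N (\<lambda>x. max 0 (- r x) *\<^sub>R h x)" using int[of "\<lambda>x. - r x"] that by simp
    then have "(\<integral>x. max 0 (r x) *\<^sub>R h x \<partial>N) - (\<integral>x. max 0 (- r x) *\<^sub>R h x \<partial>N)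
      = (\<integral>x. max 0 (r x) *\<^sub>R h x - max 0 (- r x) *\<^sub>R h x \<partial>N)"
      by (rule Bochner_Integration.integral_diff[OF int[OF that], symmetric])
    also have "\<dots> = (\<integral>x. of_real (r x) * h x \<partial>N)"
      by (intro Bochner_Integration.integral_cong refl) (auto simp: max_def scaleR_conv_of_real)
    finally show ?thesis .
  qed
  have bnd: "integrable N (\<lambda>x. of_real (r x) * h x)" if "integrable N r" for r
  proof -
    have "(\<lambda>x. of_real (r x) * h x) = (\<lambda>x. max 0 (r x) *\<^sub>R h x - max 0 (- r x) *\<^sub>R h x)"
      by (auto simp: max_def scaleR_conv_of_real)
    then show ?thesis
      using Bochner_Integration.integrable_diff[OF int[OF that] int[of "\<lambda>x. - r x"]] that by simp
  qed
  have "complex_measure_integral M (\<lambda>A. LINT x:A|N. g x) h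
    = (\<integral>x. of_real (Re (g x)) * h x \<partial>N) + \<i> * (\<integral>x. of_real (Im (g x)) * h x \<partial>N)"
    unfolding complex_measure_integral_def using sets g
    by (simp add: positive_variation_eq_density[of N M "\<lambda>x. Re (g x)"] positive_variation_eq_density[of N M "\<lambda>x. - Re (g x)"]
      positive_variation_eq_density[of N M "\<lambda>x. Im (g x)"] positive_variation_eq_density[of N M "\<lambda>x. - Im (g x)"]
      eqs dens split)
  also have "\<dots> = (\<integral>x. of_real (Re (g x)) * h x + \<i> * (of_real (Im (g x)) * h x) \<partial>N)"
    using bnd g by (subst Bochner_Integration.integral_add) auto
  also have "\<dots> = (\<integral>x. h x * g x \<partial>N)"
    by (intro Bochner_Integration.integral_cong refl)
      (simp add: complex_eq_iff algebra_simps)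
  finally show ?thesis .
qed

text \<open>
  Only an upper bound is needed, so it does not matter that \<open>measure_of\<close> yields the zero measure
  whenever the given set function fails to be a measure.
\<close>

lemma nn_integral_total_variation_le:
  assumes sets: "sets N = sets M" and g: "integrable N g" and h: "h \<in> borel_measurable M"
  shows "(\<integral>\<^sup>+x. h x \<partial>total_variation M (\<lambda>A. LINT x:A|N. g x)) \<le> (\<integral>\<^sup>+x. ennreal (cmod (g x)) * h x \<partial>N)"
proof -
  let ?\<mu> = "\<lambda>A. LINT x:A|N. g x"
  let ?D = "density N (\<lambda>x. ennreal (cmod (g x)))"
  have [measurable]: "g \<in> borel_measurable N" using g by simp
  have [measurable]: "h \<in> borel_measurable N" using h sets measurable_cong_sets by blast
  have TV_sets: "sets (total_variation M ?\<mu>) = sets M" "space (total_variation M ?\<mu>) = space M"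
    unfolding total_variation_def by (auto simp: sets.space_closed space_measure_of_conv)
  have le: "emeasure (total_variation M ?\<mu>) E \<le> emeasure ?D E" for E
  proof (cases "E \<in> sets M")
    case True
    have "(SUP A \<in> {A :: nat \<Rightarrow> 'a set. range A \<subseteq> sets M \<and> disjoint_family A \<and> (\<Union>n. A n) = E}.
        \<Sum>n. ennreal (cmod (?\<mu> (A n)))) \<le> emeasure ?D E"
    proof (rule SUP_least)
      fix A :: "nat \<Rightarrow> 'a set"
      assume "A \<in> {A. range A \<subseteq> sets M \<and> disjoint_family A \<and> (\<Union>n. A n) = E}"
      then have A: "range A \<subseteq> sets M" "disjoint_family A" "(\<Union>n. A n) = E" by auto
      have "ennreal (cmod (?\<mu> (A n))) \<le> emeasure ?D (A n)" for n
      proof -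
        have An [measurable]: "A n \<in> sets N" using A sets by auto
        have "ennreal (cmod (?\<mu> (A n))) \<le> (\<integral>\<^sup>+x. norm (indicator (A n) x *\<^sub>R g x) \<partial>N)"
          unfolding set_lebesgue_integral_def by (rule integral_norm_bound_ennreal) (intro integrable_mult_indicator An g)
        also have "\<dots> = emeasure ?D (A n)"
          by (subst emeasure_density) (auto intro!: nn_integral_cong simp: indicator_def)
        finally show ?thesis .
      qed
      then have "(\<Sum>n. ennreal (cmod (?\<mu> (A n)))) \<le> (\<Sum>n. emeasure ?D (A n))"
        by (intro suminf_le) auto
      also have "\<dots> = emeasure ?D E"
        using A sets suminf_emeasure[of A ?D] by simp
      finally show "(\<Sum>n. ennreal (cmod (?\<mu> (A n)))) \<le> emeasure ?D E" .
    qed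
    then show ?thesis
      unfolding total_variation_def emeasure_measure_of_conv by simp
  next
    case False
    then show ?thesis using emeasure_notin_sets TV_sets by (metis zero_le)
  qed
  \<comment> \<open>With equal spaces and sigma-algebras the order on measures is the setwise order,
    so the bound passes to integrals of \<open>h\<close>.\<close>
  have "total_variation M ?\<mu> \<le> ?D"
    using le TV_sets sets sets_eq_imp_space_eq[OF sets] by (auto simp: less_eq_measure.simps le_fun_def)
  then have "(\<integral>\<^sup>+x. h x \<partial>total_variation M ?\<mu>) \<le> (\<integral>\<^sup>+x. h x \<partial>?D)"
    using TV_sets sets by (intro nn_integral_mono_measure) auto
  also have "\<dots> = (\<integral>\<^sup>+x. ennreal (cmod (g x)) * h x \<partial>N)"
    by (rule nn_integral_density) auto
  finally show ?thesis .
qed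

section \<open>Fourier integrals of real functions as general Barron functions\<close>

lemma lborel_distr_uminus_euclidean: "distr lborel borel uminus = (lborel :: 'a::euclidean_space measure)"
  using lborel_affine[of "- 1" "0 :: 'a"] by (simp add: density_1)

lemma cmod_exp_ii_minus_1_le: "cmod (exp (\<i> * complex_of_real t) - 1) \<le> 2"
  using norm_triangle_ineq4[of "exp (\<i> * complex_of_real t)" 1] by simp

lemma integrable_exp_ii_minus_1:
  fixes F :: "'a::euclidean_space \<Rightarrow> complex"
  assumes "integrable lborel F"
  shows "integrable lborel (\<lambda>\<xi>. (exp (\<i> * complex_of_real (x \<bullet> \<xi>)) - 1) * F \<xi>)"
proof (rule Bochner_Integration.integrable_bound[OF integrable_mult_right[OF integrable_norm[OF assms], of 2]])
  show "(\<lambda>\<xi>. (exp (\<i> * complex_of_real (x \<bullet> \<xi>)) - 1) * F \<xi>) \<in> borel_measurable lborel"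
    using assms by measurable
qed (auto simp: norm_mult intro!: AE_I2 mult_right_mono cmod_exp_ii_minus_1_le)

text \<open>The reflected conjugate of a density has the conjugate Fourier integral, so averaging
  the two yields the real part. Thus a density only has to represent a real function through the
  real part of its integral. The moment does not grow, by the triangle inequality and reflection
  invariance.\<close>

lemma fourier_symmetrize:
  fixes F :: "'a::euclidean_space \<Rightarrow> complex"
  assumes F: "integrable lborel F"
  defines "G \<equiv> \<lambda>\<xi>. (F \<xi> + cnj (F (- \<xi>))) / 2"
  shows "integrable lborel G"
    and "(\<integral>\<xi>. (exp (\<i> * complex_of_real (x \<bullet> \<xi>)) - 1) * G \<xi> \<partial>lborel)
       = complex_of_real (Re (\<integral>\<xi>. (exp (\<i> * complex_of_real (x \<bullet> \<xi>)) - 1) * F \<xi> \<partial>lborel))"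
    and "(\<integral>\<^sup>+\<xi>. ennreal (norm \<xi> * cmod (G \<xi>)) \<partial>lborel) \<le> (\<integral>\<^sup>+\<xi>. ennreal (norm \<xi> * cmod (F \<xi>)) \<partial>lborel)"
proof -
  have [measurable]: "F \<in> borel_measurable borel" using F by simp
  have refl_int: "integrable lborel (\<lambda>\<xi>. f (- \<xi>))" "(\<integral>\<xi>. f (- \<xi>) \<partial>lborel) = (\<integral>\<xi>. f \<xi> \<partial>lborel)"
    if f: "integrable lborel f" for f :: "'a \<Rightarrow> complex"
  proof -
    have [measurable]: "f \<in> borel_measurable borel" using f by simp
    show "integrable lborel (\<lambda>\<xi>. f (- \<xi>))"
      using f integrable_distr_eq[of uminus lborel borel f] by (simp add: lborel_distr_uminus_euclidean)
    show "(\<integral>\<xi>. f (- \<xi>) \<partial>lborel) = (\<integral>\<xi>. f \<xi> \<partial>lborel)"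
      using integral_distr[of uminus lborel borel f] by (simp add: lborel_distr_uminus_euclidean)
  qed
  show "integrable lborel G" unfolding G_def using F refl_int(1)[OF F] by simp
  let ?e = "\<lambda>\<xi>. exp (\<i> * complex_of_real (x \<bullet> \<xi>)) - 1"
  let ?I = "\<integral>\<xi>. ?e \<xi> * F \<xi> \<partial>lborel"
  have int: "integrable lborel (\<lambda>\<xi>. ?e \<xi> * F \<xi>)" by (rule integrable_exp_ii_minus_1[OF F])
  \<comment> \<open>Reflecting and conjugating the exponential factor gives it back.\<close>
  have cnj: "?e \<xi> * cnj (F (- \<xi>)) = cnj (?e (- \<xi>) * F (- \<xi>))" for \<xi>
    by (simp add: exp_cnj)
  have "(\<integral>\<xi>. ?e \<xi> * G \<xi> \<partial>lborel) = (\<integral>\<xi>. (?e \<xi> * F \<xi> + cnj (?e (- \<xi>) * F (- \<xi>))) / 2 \<partial>lborel)"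
    by (intro Bochner_Integration.integral_cong refl) (simp only: cnj[symmetric], simp add: G_def algebra_simps)
  also have "\<dots> = (?I + cnj ?I) / 2"
    using int refl_int[OF int] by (simp del: complex_cnj_mult)
  also have "\<dots> = complex_of_real (Re ?I)" by (simp add: complex_add_cnj)
  finally show "(\<integral>\<xi>. ?e \<xi> * G \<xi> \<partial>lborel) = complex_of_real (Re ?I)" .
  have half: "ennreal (1/2 * a + 1/2 * b) = ennreal (1/2) * ennreal a + ennreal (1/2) * ennreal b"
    if "0 \<le> a" "0 \<le> b" for a b
    using that ennreal_mult[of "1/2" a] ennreal_mult[of "1/2" b] ennreal_plus[of "1/2 * a" "1/2 * b"] by simp
  have "(\<integral>\<^sup>+\<xi>. ennreal (norm \<xi> * cmod (G \<xi>)) \<partial>lborel)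
    \<le> (\<integral>\<^sup>+\<xi>. ennreal (1/2) * ennreal (norm \<xi> * cmod (F \<xi>)) + ennreal (1/2) * ennreal (norm (- \<xi>) * cmod (F (- \<xi>))) \<partial>lborel)"
  proof (rule nn_integral_mono)
    fix \<xi> :: 'a
    have "cmod (G \<xi>) \<le> (cmod (F \<xi>) + cmod (F (- \<xi>))) / 2"
      using norm_triangle_ineq[of "F \<xi>" "cnj (F (- \<xi>))"] by (simp add: G_def norm_divide)
    then have "norm \<xi> * cmod (G \<xi>) \<le> norm \<xi> * ((cmod (F \<xi>) + cmod (F (- \<xi>))) / 2)"
      by (intro mult_left_mono) auto
    also have "\<dots> = 1/2 * (norm \<xi> * cmod (F \<xi>)) + 1/2 * (norm (- \<xi>) * cmod (F (- \<xi>)))"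
      by (simp add: algebra_simps)
    finally have "norm \<xi> * cmod (G \<xi>) \<le> 1/2 * (norm \<xi> * cmod (F \<xi>)) + 1/2 * (norm (- \<xi>) * cmod (F (- \<xi>)))" .
    from ennreal_leI[OF this] show "ennreal (norm \<xi> * cmod (G \<xi>)) \<le> ennreal (1/2) * ennreal (norm \<xi> * cmod (F \<xi>)) + ennreal (1/2) * ennreal (norm (- \<xi>) * cmod (F (- \<xi>)))"
      by (subst (asm) half) auto
  qed
  also have "\<dots> = ennreal (1/2) * (\<integral>\<^sup>+\<xi>. ennreal (norm \<xi> * cmod (F \<xi>)) \<partial>lborel)
      + ennreal (1/2) * (\<integral>\<^sup>+\<xi>. ennreal (norm (- \<xi>) * cmod (F (- \<xi>))) \<partial>lborel)"
    by (simp add: nn_integral_add nn_integral_cmult)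
  also have "(\<integral>\<^sup>+\<xi>. ennreal (norm (- \<xi>) * cmod (F (- \<xi>))) \<partial>lborel) = (\<integral>\<^sup>+\<xi>. ennreal (norm \<xi> * cmod (F \<xi>)) \<partial>lborel)"
    using nn_integral_distr[of uminus lborel borel "\<lambda>\<xi>. ennreal (norm \<xi> * cmod (F \<xi>))"]
    by (simp add: lborel_distr_uminus_euclidean)
  also have "ennreal (1/2) * I + ennreal (1/2) * I = I" for I
  proof -
    have "ennreal (1/2) + ennreal (1/2) = 1" by (subst ennreal_plus[symmetric]) auto
    then show ?thesis by (metis distrib_right mult_1)
  qed
  finally show "(\<integral>\<^sup>+\<xi>. ennreal (norm \<xi> * cmod (G \<xi>)) \<partial>lborel) \<le> (\<integral>\<^sup>+\<xi>. ennreal (norm \<xi> * cmod (F \<xi>)) \<partial>lborel)" .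
qed

text \<open>Passing from \<open>exp (\<i> * ...)\<close> to \<open>exp (2 * pi * \<i> * ...)\<close>
  divides frequencies by \<open>2 * pi\<close>, and with them the first moment; hence the generous
  bound in \<open>mom\<close>.\<close>

lemma general_barron_fourier:
  fixes f :: "real ^ 'n \<Rightarrow> real" and F :: "real ^ 'n \<Rightarrow> complex"
  assumes f: "f \<in> unit_cube \<rightarrow>\<^sub>E UNIV" and c: "c \<in> {- C..C}" and F: "integrable lborel F"
    and rep: "\<And>x. x \<in> unit_cube \<Longrightarrow> f x = c + Re (\<integral>\<xi>. (exp (\<i> * complex_of_real (x \<bullet> \<xi>)) - 1) * F \<xi> \<partial>lborel)"
    and mom: "(\<integral>\<^sup>+\<xi>. ennreal (norm \<xi> * cmod (F \<xi>)) \<partial>lborel) \<le> ennreal (2 * pi * C)"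
  shows "f \<in> general_barron C"
proof -
  define G where "G \<xi> = (F \<xi> + cnj (F (- \<xi>))) / 2" for \<xi>
  note sym = fourier_symmetrize[OF F, folded G_def]
  \<comment> \<open>The rescaling is put into the reference measure, the image \<open>N\<close> of
    \<open>lborel\<close> under \<open>T\<close>. The density is merely composed with the inverse of
    \<open>T\<close>, so no Jacobian appears.\<close>
  define T where "T \<xi> = (1 / (2 * pi)) *\<^sub>R \<xi>" for \<xi> :: "real ^ 'n"
  define N where "N = distr lborel borel T"
  define g where "g \<xi> = G ((2 * pi) *\<^sub>R \<xi>)" for \<xi>
  have [measurable]: "T \<in> borel \<rightarrow>\<^sub>M borel" "G \<in> borel_measurable borel"
    using sym(1) by (auto simp: T_def[abs_def])
  have [measurable]: "g \<in> borel_measurable borel" unfolding g_def[abs_def] by measurable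
  have gT: "g (T \<xi>) = G \<xi>" for \<xi> by (simp add: g_def T_def)
  have sets: "sets N = sets borel" by (simp add: N_def)
  have g: "integrable N g"
    unfolding N_def using sym(1) by (subst integrable_distr_eq) (auto simp: gT)
  let ?\<mu> = "\<lambda>A. LINT x:A|N. g x"
  have "complex_of_real (f x) = complex_of_real c + complex_measure_integral borel ?\<mu>
              (\<lambda>\<xi>. exp (2 * complex_of_real pi * \<i> * complex_of_real (x \<bullet> \<xi>)) - 1)"
    if x: "x \<in> unit_cube" for x
  proof -
    have eq: "2 * complex_of_real pi * \<i> * complex_of_real (x \<bullet> \<xi>) = \<i> * complex_of_real (2 * pi * (x \<bullet> \<xi>))" for \<xi>
      by simp
    have "complex_measure_integral borel ?\<mu> (\<lambda>\<xi>. exp (2 * complex_of_real pi * \<i> * complex_of_real (x \<bullet> \<xi>)) - 1)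
      = (\<integral>\<xi>. (exp (2 * complex_of_real pi * \<i> * complex_of_real (x \<bullet> \<xi>)) - 1) * g \<xi> \<partial>N)"
      by (rule complex_measure_integral_density[OF sets g, where B = 2])
        (auto simp: eq N_def simp del: of_real_mult intro!: cmod_exp_ii_minus_1_le)
    also have "\<dots> = (\<integral>\<xi>. (exp (\<i> * complex_of_real (x \<bullet> \<xi>)) - 1) * G \<xi> \<partial>lborel)"
      unfolding N_def eq by (subst integral_distr) (auto simp: gT, simp add: T_def)
    finally show ?thesis using rep[OF x] sym(2)[of x] by simp
  qed
  moreover have "(\<integral>\<^sup>+\<xi>. ennreal (norm \<xi>) \<partial>total_variation borel ?\<mu>) \<le> ennreal C"
  proof -
    have "(\<integral>\<^sup>+\<xi>. ennreal (norm \<xi>) \<partial>total_variation borel ?\<mu>) \<le> (\<integral>\<^sup>+\<xi>. ennreal (cmod (g \<xi>)) * ennreal (norm \<xi>) \<partial>N)"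
      by (rule nn_integral_total_variation_le[OF sets g]) simp
    also have "\<dots> = (\<integral>\<^sup>+\<xi>. ennreal (1 / (2 * pi)) * ennreal (norm \<xi> * cmod (G \<xi>)) \<partial>lborel)"
      unfolding N_def
      by (subst nn_integral_distr) (auto simp: gT, simp add: T_def ennreal_mult[symmetric] mult_ac)
    also have "\<dots> = ennreal (1 / (2 * pi)) * (\<integral>\<^sup>+\<xi>. ennreal (norm \<xi> * cmod (G \<xi>)) \<partial>lborel)"
      by (rule nn_integral_cmult) simp
    also have "\<dots> \<le> ennreal (1 / (2 * pi)) * ennreal (2 * pi * C)"
      using order_trans[OF sym(3) mom] by (rule mult_left_mono) simp
    \<comment> \<open>The interval containing \<open>c\<close> is nonempty, which gives
      \<open>0 \<le> C\<close>.\<close>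
    also have "\<dots> = ennreal C"
      using c by (simp add: ennreal_mult[symmetric])
    finally show ?thesis .
  qed
  ultimately show ?thesis
    using f c complex_measure_density[OF sets g] unfolding general_barron_def by blast
qed

subsection \<open>Approximating Barron functions by general Barron functions\<close>

lemma cmod_exp_ii_minus_1_le_abs: "cmod (exp (\<i> * complex_of_real t) - 1) \<le> \<bar>t\<bar>"
  using iexp_approx1[of t 0] by simp

lemma unit_cube_nth: "x \<in> unit_cube \<longleftrightarrow> (\<forall>i. 0 \<le> x $ i \<and> x $ i \<le> 1)"
  by (simp add: mem_box_cart)

lemma half_le_sin:
  fixes t :: real
  assumes t: "0 \<le> t" "t \<le> 1"
  shows "t / 2 \<le> sin t"
proof -
  have "\<bar>sin t - t\<bar> \<le> t\<^sup>2 / 2"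
    using Maclaurin_sin_bound[of t 2] by (simp add: numeral_2_eq_2 sin_coeff_def)
  moreover have "t\<^sup>2 \<le> t" using t by (simp add: power2_eq_square mult_left_le)
  ultimately have "\<bar>sin t - t\<bar> \<le> t / 2" by linarith
  then show ?thesis by linarith
qed

lemma barron_integral_measurable:
  fixes F :: "real ^ 'n \<Rightarrow> complex"
  assumes [measurable]: "F \<in> borel_measurable borel"
  shows "(\<lambda>x. Re (\<integral>\<xi>. (exp (\<i> * complex_of_real (x \<bullet> \<xi>)) - 1) * F \<xi> \<partial>lborel)) \<in> borel_measurable borel"
  by measurable

text \<open>An extensional function is described only on the cube; its measurability there is
  borrowed from a Borel function \<open>g\<close> on the whole space.\<close>

lemma set_integrable_unit_cube:
  fixes f g :: "real ^ 'n \<Rightarrow> real"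
  assumes g: "g \<in> borel_measurable borel" and eq: "\<And>x. x \<in> unit_cube \<Longrightarrow> f x = g x"
    and bound: "\<And>x. x \<in> unit_cube \<Longrightarrow> f x \<in> {0..1}"
  shows "set_integrable lborel unit_cube f"
proof -
  have "set_integrable lborel unit_cube g"
    unfolding set_integrable_def
  proof (rule integrableI_bounded_set[where A = unit_cube and B = 1])
    show "AE x in lborel. x \<in> unit_cube \<longrightarrow> norm (indicator unit_cube x *\<^sub>R g x) \<le> 1"
      using bound eq by (intro AE_I2) (fastforce simp: indicator_def)
    show "emeasure lborel (unit_cube :: (real ^ 'n) set) < \<infinity>"
      by (simp add: emeasure_lborel_cbox_eq)
  qed (use g in auto)
  then show ?thesis
    by (rule set_integrable_cong[THEN iffD1, rotated -1]) (auto simp: eq)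
qed

lemma set_integrable_barron:
  assumes "f \<in> barron C"
  shows "set_integrable lborel unit_cube f"
proof -
  obtain F c where [measurable]: "F \<in> borel_measurable borel"
    and rep: "\<And>x. x \<in> unit_cube \<Longrightarrow> complex_of_real (f x) = complex_of_real c
          + (\<integral>\<xi>. (exp (\<i> * complex_of_real (x \<bullet> \<xi>)) - 1) * F \<xi> \<partial>lborel)"
    and range: "f \<in> unit_cube \<rightarrow>\<^sub>E {0..1}"
    using assms unfolding barron_def by blast
  have "f x = c + Re (\<integral>\<xi>. (exp (\<i> * complex_of_real (x \<bullet> \<xi>)) - 1) * F \<xi> \<partial>lborel)" if "x \<in> unit_cube" for x
    using arg_cong[OF rep[OF that], of Re] by simp
  moreover have "(\<lambda>x. c + Re (\<integral>\<xi>. (exp (\<i> * complex_of_real (x \<bullet> \<xi>)) - 1) * F \<xi> \<partial>lborel)) \<in> borel_measurable borel"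
    using barron_integral_measurable[of F] by simp
  ultimately show ?thesis
    using range PiE_mem[OF range] by (intro set_integrable_unit_cube) blast+
qed

text \<open>Dominated convergence: the balls shrink to the origin, where the factor
  \<open>norm \<xi>\<close> vanishes.\<close>

lemma low_frequency_small:
  fixes F :: "'a::euclidean_space \<Rightarrow> complex"
  assumes int: "integrable lborel (\<lambda>\<xi>. norm \<xi> * cmod (F \<xi>))" and "0 < \<delta>"
  obtains r where "0 < r" "(\<integral>\<xi>. indicator {\<xi>. norm \<xi> \<le> r} \<xi> * (norm \<xi> * cmod (F \<xi>)) \<partial>lborel) < \<delta>"
proof -
  let ?u = "\<lambda>n \<xi>. indicator {\<xi>. norm \<xi> \<le> 1 / real (Suc n)} \<xi> * (norm \<xi> * cmod (F \<xi>))"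
  have "(\<lambda>n. \<integral>\<xi>. ?u n \<xi> \<partial>lborel) \<longlonglongrightarrow> (\<integral>\<xi>. 0 \<partial>(lborel :: 'a measure))"
  proof (rule integral_dominated_convergence[where w = "\<lambda>\<xi>. norm \<xi> * cmod (F \<xi>)"])
    show "?u n \<in> borel_measurable lborel" for n
      using borel_measurable_integrable[OF int] by measurable
    show "AE \<xi> in lborel. (\<lambda>n. ?u n \<xi>) \<longlonglongrightarrow> 0"
    proof (rule AE_I2)
      fix \<xi> :: 'a
      show "(\<lambda>n. ?u n \<xi>) \<longlonglongrightarrow> 0"
      proof (cases "\<xi> = 0")
        case False
        then have "\<forall>\<^sub>F n in sequentially. 1 / real (Suc n) < norm \<xi>"
          using order_tendstoD(2)[OF LIMSEQ_inverse_real_of_nat, of "norm \<xi>"] by (simp add: inverse_eq_divide)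
        then show ?thesis
          by (intro tendsto_eventually) (erule eventually_mono, simp add: indicator_def)
      qed simp
    qed
  qed (use int in \<open>auto simp: indicator_def intro!: AE_I2\<close>)
  then have "\<forall>\<^sub>F n in sequentially. (\<integral>\<xi>. ?u n \<xi> \<partial>lborel) < \<delta>"
    using \<open>0 < \<delta>\<close> by (intro order_tendstoD(2)[where y = 0]) auto
  then obtain n where "(\<integral>\<xi>. ?u n \<xi> \<partial>lborel) < \<delta>" by (auto simp: eventually_sequentially)
  then show ?thesis using that[of "1 / real (Suc n)"] by simp
qed

text \<open>Cutting off the ball of radius \<open>r\<close> makes the density integrable, because
  outside it \<open>1 \<le> norm \<xi> / r\<close>. The removed part costs little since the
  exponential factor is at most \<open>norm x * norm \<xi>\<close> in modulus.\<close>

lemma high_frequency_part: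
  fixes F :: "'a::euclidean_space \<Rightarrow> complex"
  assumes F [measurable]: "F \<in> borel_measurable borel"
    and int: "integrable lborel (\<lambda>\<xi>. norm \<xi> * cmod (F \<xi>))" and "0 < \<delta>"
  shows "\<exists>G. integrable lborel G \<and> (\<forall>\<xi>. cmod (G \<xi>) \<le> cmod (F \<xi>))
    \<and> (\<forall>x. cmod ((\<integral>\<xi>. (exp (\<i> * complex_of_real (x \<bullet> \<xi>)) - 1) * F \<xi> \<partial>lborel)
           - (\<integral>\<xi>. (exp (\<i> * complex_of_real (x \<bullet> \<xi>)) - 1) * G \<xi> \<partial>lborel)) \<le> \<delta> * norm x)"
proof -
  obtain r where r: "0 < r" "(\<integral>\<xi>. indicator {\<xi>. norm \<xi> \<le> r} \<xi> * (norm \<xi> * cmod (F \<xi>)) \<partial>lborel) < \<delta>"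
    using low_frequency_small[OF int \<open>0 < \<delta>\<close>] .
  let ?e = "\<lambda>x \<xi>. exp (\<i> * complex_of_real (x \<bullet> \<xi>)) - 1"
  define G where "G \<xi> = indicator {\<xi>. r < norm \<xi>} \<xi> * F \<xi>" for \<xi>
  have [measurable]: "G \<in> borel_measurable borel" unfolding G_def[abs_def] by measurable
  have G: "integrable lborel G"
  proof (rule Bochner_Integration.integrable_bound[OF integrable_mult_right[OF int, of "1 / r"]])
    have "cmod (G \<xi>) \<le> 1 / r * (norm \<xi> * cmod (F \<xi>))" for \<xi>
    proof (cases "r < norm \<xi>")
      case True
      then have "1 * cmod (F \<xi>) \<le> (norm \<xi> / r) * cmod (F \<xi>)"
        using r(1) by (intro mult_right_mono) auto
      then show ?thesis using True by (simp add: G_def)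
    qed (use r(1) in \<open>simp add: G_def\<close>)
    then show "AE \<xi> in lborel. norm (G \<xi>) \<le> norm (1 / r * (norm \<xi> * cmod (F \<xi>)))"
      by (intro AE_I2) (metis abs_ge_self order_trans real_norm_def)
  qed simp
  have e: "cmod (?e x \<xi> * F \<xi>) \<le> norm x * (norm \<xi> * cmod (F \<xi>))" for x \<xi>
    unfolding norm_mult mult.assoc[symmetric]
    by (intro mult_right_mono order_trans[OF cmod_exp_ii_minus_1_le_abs Cauchy_Schwarz_ineq2]) simp
  have eF: "integrable lborel (\<lambda>\<xi>. ?e x \<xi> * F \<xi>)" for x
  proof (rule Bochner_Integration.integrable_bound[OF integrable_mult_right[OF int, of "norm x"]])
    show "AE \<xi> in lborel. norm (?e x \<xi> * F \<xi>) \<le> norm (norm x * (norm \<xi> * cmod (F \<xi>)))"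
      using e[of x] by (intro AE_I2) (metis abs_ge_self order_trans real_norm_def)
  qed simp
  have "cmod ((\<integral>\<xi>. ?e x \<xi> * F \<xi> \<partial>lborel) - (\<integral>\<xi>. ?e x \<xi> * G \<xi> \<partial>lborel)) \<le> \<delta> * norm x" for x
  proof -
    let ?low = "\<lambda>\<xi>. ?e x \<xi> * F \<xi> - ?e x \<xi> * G \<xi>"
    have eG: "integrable lborel (\<lambda>\<xi>. ?e x \<xi> * G \<xi>)" by (rule integrable_exp_ii_minus_1[OF G])
    have "(\<integral>\<xi>. ?e x \<xi> * F \<xi> \<partial>lborel) - (\<integral>\<xi>. ?e x \<xi> * G \<xi> \<partial>lborel) = (\<integral>\<xi>. ?low \<xi> \<partial>lborel)"
      by (rule Bochner_Integration.integral_diff[OF eF eG, symmetric])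
    then have "cmod ((\<integral>\<xi>. ?e x \<xi> * F \<xi> \<partial>lborel) - (\<integral>\<xi>. ?e x \<xi> * G \<xi> \<partial>lborel)) \<le> (\<integral>\<xi>. cmod (?low \<xi>) \<partial>lborel)"
      by (simp only: integral_norm_bound)
    also have "\<dots> \<le> (\<integral>\<xi>. norm x * (indicator {\<xi>. norm \<xi> \<le> r} \<xi> * (norm \<xi> * cmod (F \<xi>))) \<partial>lborel)"
    proof (rule integral_mono)
      show "integrable lborel (\<lambda>\<xi>. cmod (?low \<xi>))"
        by (rule integrable_norm[OF Bochner_Integration.integrable_diff[OF eF eG]])
      show "integrable lborel (\<lambda>\<xi>. norm x * (indicator {\<xi>. norm \<xi> \<le> r} \<xi> * (norm \<xi> * cmod (F \<xi>))))"
        using integrable_mult_indicator[OF _ int, of "{\<xi>. norm \<xi> \<le> r}"] by simp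
      show "cmod (?low \<xi>) \<le> norm x * (indicator {\<xi>. norm \<xi> \<le> r} \<xi> * (norm \<xi> * cmod (F \<xi>)))" for \<xi>
        using e[of x \<xi>] by (cases "r < norm \<xi>") (auto simp: G_def)
    qed
    also have "\<dots> = norm x * (\<integral>\<xi>. indicator {\<xi>. norm \<xi> \<le> r} \<xi> * (norm \<xi> * cmod (F \<xi>)) \<partial>lborel)"
      by simp
    also have "\<dots> \<le> norm x * \<delta>" using r(2) by (intro mult_left_mono) auto
    finally show ?thesis by (simp add: mult.commute)
  qed
  moreover have "cmod (G \<xi>) \<le> cmod (F \<xi>)" for \<xi> by (simp add: G_def indicator_def)
  ultimately show ?thesis using G by blast
qed

text \<open>A multiple of the average of \<open>sin (x \<bullet> \<xi>)\<close> over a small cube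
  \<open>S\<close> of frequencies with positive coordinates. On the unit cube the argument stays in
  \<open>[0, 1]\<close>, where the sine is at least half its argument, so the average dominates a
  multiple of \<open>norm x\<close>.\<close>

lemma cone_on_unit_cube:
  "\<exists>H :: real ^ 'n \<Rightarrow> complex. integrable lborel H
    \<and> (\<integral>\<^sup>+\<xi>. ennreal (norm \<xi> * cmod (H \<xi>)) \<partial>lborel) \<le> ennreal (4 * real CARD('n))
    \<and> (\<forall>x\<in>unit_cube. norm x \<le> Re (\<integral>\<xi>. (exp (\<i> * complex_of_real (x \<bullet> \<xi>)) - 1) * H \<xi> \<partial>lborel)
      \<and> Re (\<integral>\<xi>. (exp (\<i> * complex_of_real (x \<bullet> \<xi>)) - 1) * H \<xi> \<partial>lborel) \<le> 4 * real CARD('n))"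
proof -
  define d where "d = real CARD('n)"
  have d: "1 \<le> d" by (simp add: d_def Suc_leI)
  \<comment> \<open>The upper bound \<open>1 / d\<close> gives
    \<open>x \<bullet> \<xi> \<le> 1\<close> and \<open>norm \<xi> \<le> 1\<close>. The lower bound
    gives \<open>norm x / (2 * d) \<le> x \<bullet> \<xi>\<close>, and the gap between the bounds
    gives \<open>S\<close> positive volume.\<close>
  define S :: "(real ^ 'n) set" where "S = cbox (\<chi> i. 1 / (2 * d)) (\<chi> i. 1 / d)"
  have S: "\<xi> \<in> S \<longleftrightarrow> (\<forall>i. 1 / (2 * d) \<le> \<xi> $ i \<and> \<xi> $ i \<le> 1 / d)" for \<xi>
    by (simp add: S_def mem_box_cart)
  have S0: "0 \<le> \<xi> $ i" if "\<xi> \<in> S" for \<xi> i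
  proof -
    have "0 \<le> 1 / (2 * d)" using d by simp
    also have "\<dots> \<le> \<xi> $ i" using that by (simp only: S)
    finally show ?thesis .
  qed
  define v where "v = measure lborel S"
  have "v = (\<Prod>i\<in>(UNIV :: 'n set). 1 / d - 1 / (2 * d))"
    unfolding v_def S_def using d
    by (subst content_cbox_cart) (simp_all add: interval_eq_empty_cart not_less frac_le)
  moreover have "0 < 1 / d - 1 / (2 * d)" using d by (simp add: field_simps)
  ultimately have v: "0 < v" by (simp add: prod_pos)
  have fin: "emeasure lborel S < \<infinity>" by (simp add: S_def emeasure_lborel_cbox_eq)
  have mS [measurable]: "S \<in> sets borel" by (simp add: S_def)
  have norm_S: "norm \<xi> \<le> 1" if "\<xi> \<in> S" for \<xi>
  proof -
    have "norm \<xi> \<le> (\<Sum>i\<in>(UNIV::'n set). 1 / d)"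
    proof (intro order_trans[OF norm_le_l1_cart] sum_mono)
      show "\<bar>\<xi> $ i\<bar> \<le> 1 / d" for i
        using that S0[OF that, of i] by (simp only: S abs_of_nonneg)
    qed
    then show ?thesis using d by (simp add: d_def)
  qed
  have sin: "norm x / (4 * d) \<le> sin (x \<bullet> \<xi>)" if x: "x \<in> unit_cube" and \<xi>: "\<xi> \<in> S" for x \<xi>
  proof -
    have x0: "0 \<le> x $ i" "x $ i \<le> 1" for i using x by (auto simp: unit_cube_nth)
    have "norm x \<le> (\<Sum>i\<in>UNIV. x $ i)"
      using norm_le_l1_cart[of x] x0 by simp
    then have "norm x / (2 * d) \<le> (\<Sum>i\<in>UNIV. x $ i * (1 / (2 * d)))"
      using d by (simp add: sum_divide_distrib[symmetric] divide_right_mono)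
    also have "\<dots> \<le> x \<bullet> \<xi>"
      unfolding inner_vec_def inner_real_def using x0 \<xi> by (intro sum_mono mult_left_mono) (simp_all only: S)
    finally have 1: "norm x / (2 * d) \<le> x \<bullet> \<xi>" .
    have "x \<bullet> \<xi> \<le> (\<Sum>i\<in>(UNIV::'n set). 1 * (1 / d))"
      unfolding inner_vec_def inner_real_def
      using x0 \<xi> S0[OF \<xi>] by (intro sum_mono mult_mono) (simp_all only: S zero_le_one)
    also have "\<dots> = 1" using d by (simp add: d_def)
    finally have 2: "x \<bullet> \<xi> \<le> 1" .
    have "0 \<le> norm x / (2 * d)" using d by simp
    then have "(x \<bullet> \<xi>) / 2 \<le> sin (x \<bullet> \<xi>)" using 1 2 by (intro half_le_sin) auto
    then show ?thesis using 1 by simp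
  qed
  \<comment> \<open>The factor \<open>- \<i>\<close> turns the real part of
    \<open>exp (\<i> * t) - 1\<close> into \<open>sin t\<close>.\<close>
  define H where "H \<xi> = - \<i> * complex_of_real (4 * d / v * indicator S \<xi>)" for \<xi>
  have intS: "integrable lborel (\<lambda>\<xi>. indicator S \<xi> * a)" for a :: real
    using fin by simp
  have H: "integrable lborel H"
    unfolding H_def using intS[of 1] by (intro integrable_mult_right integrable_of_real) simp
  define h where "h x = (\<integral>\<xi>. indicator S \<xi> * sin (x \<bullet> \<xi>) \<partial>lborel)" for x
  have intsin: "integrable lborel (\<lambda>\<xi>. indicator S \<xi> * sin (x \<bullet> \<xi>))" for x
    by (rule Bochner_Integration.integrable_bound[OF intS[of 1]]) (auto simp: abs_mult indicator_def intro!: AE_I2)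
  have Hh: "Re (\<integral>\<xi>. (exp (\<i> * complex_of_real (x \<bullet> \<xi>)) - 1) * H \<xi> \<partial>lborel) = 4 * d / v * h x" for x
  proof -
    have "Re (\<integral>\<xi>. (exp (\<i> * complex_of_real (x \<bullet> \<xi>)) - 1) * H \<xi> \<partial>lborel)
      = (\<integral>\<xi>. Re ((exp (\<i> * complex_of_real (x \<bullet> \<xi>)) - 1) * H \<xi>) \<partial>lborel)"
      using integrable_exp_ii_minus_1[OF H] by (rule integral_Re[symmetric])
    also have "\<dots> = (\<integral>\<xi>. 4 * d / v * (indicator S \<xi> * sin (x \<bullet> \<xi>)) \<partial>lborel)"
      by (intro Bochner_Integration.integral_cong refl) (simp add: H_def Im_exp)
    finally show ?thesis by (simp add: h_def)
  qed
  have h: "v * (norm x / (4 * d)) \<le> h x" "h x \<le> v" if x: "x \<in> unit_cube" for x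
  proof -
    have "(\<integral>\<xi>. indicator S \<xi> * (norm x / (4 * d)) \<partial>lborel) \<le> h x"
      unfolding h_def using sin[OF x] by (intro integral_mono intS intsin) (auto simp: indicator_def)
    then show "v * (norm x / (4 * d)) \<le> h x" by (simp add: v_def)
    have "h x \<le> (\<integral>\<xi>. indicator S \<xi> * 1 \<partial>lborel)"
      unfolding h_def by (intro integral_mono intS intsin) (auto simp: indicator_def)
    then show "h x \<le> v" by (simp add: v_def)
  qed
  have "(\<integral>\<^sup>+\<xi>. ennreal (norm \<xi> * cmod (H \<xi>)) \<partial>lborel) \<le> (\<integral>\<^sup>+\<xi>. ennreal (4 * d / v) * indicator S \<xi> \<partial>lborel)"
  proof (rule nn_integral_mono)
    fix \<xi>
    have "norm \<xi> * (4 * d / v) \<le> 1 * (4 * d / v)" if "\<xi> \<in> S"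
      using norm_S[OF that] v d by (intro mult_right_mono) auto
    then show "ennreal (norm \<xi> * cmod (H \<xi>)) \<le> ennreal (4 * d / v) * indicator S \<xi>"
      using v d by (cases "\<xi> \<in> S") (auto simp: H_def norm_mult norm_divide intro!: ennreal_leI)
  qed
  also have "\<dots> = ennreal (4 * d / v) * ennreal v"
    using fin by (simp add: nn_integral_cmult_indicator v_def emeasure_eq_ennreal_measure)
  also have "\<dots> = ennreal (4 * d)" using v d by (simp add: ennreal_mult[symmetric])
  finally have mom: "(\<integral>\<^sup>+\<xi>. ennreal (norm \<xi> * cmod (H \<xi>)) \<partial>lborel) \<le> ennreal (4 * d)" .
  have "norm x \<le> 4 * d / v * h x" "4 * d / v * h x \<le> 4 * d" if x: "x \<in> unit_cube" for x
  proof -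
    have "4 * d / v * (v * (norm x / (4 * d))) \<le> 4 * d / v * h x" "4 * d / v * h x \<le> 4 * d / v * v"
      using h[OF x] v d by (intro mult_left_mono; simp)+
    then show "norm x \<le> 4 * d / v * h x" "4 * d / v * h x \<le> 4 * d" using v d by simp_all
  qed
  then show ?thesis using H mom unfolding d_def[symmetric] Hh[symmetric] by blast
qed

text \<open>
  A density in the definition of \<open>barron\<close> may fail to be integrable at the origin, so it is cut off
  there. The error is at most \<open>\<delta> * norm x\<close>; adding \<open>\<delta>\<close> times the function of the previous lemma, which
  vanishes at 0, makes it one-sided without changing the constant \<open>c\<close>, and then scaling by \<open>s < 1\<close>
  restores the range \<open>{0..1}\<close>. The factor \<open>2 * pi\<close> between the two normalizations of the Fourier
  integral absorbs the increase of the moment.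
\<close>

lemma barron_approx:
  fixes f :: "real ^ 'n \<Rightarrow> real"
  assumes "0 < C" and f: "f \<in> barron C" and "0 < \<eta>"
  obtains f' where "f' \<in> general_barron_star C" "set_integrable lborel unit_cube f'"
    and "\<And>x. x \<in> unit_cube \<Longrightarrow> \<bar>f' x - f x\<bar> \<le> \<eta>"
proof -
  let ?e = "\<lambda>x \<xi>. exp (\<i> * complex_of_real (x \<bullet> \<xi>)) - 1"
  obtain F c where F [measurable]: "F \<in> borel_measurable borel"
    and c: "c \<in> {- C..C}"
    and rep: "\<And>x. x \<in> unit_cube \<Longrightarrow> complex_of_real (f x) = complex_of_real c + (\<integral>\<xi>. ?e x \<xi> * F \<xi> \<partial>lborel)"
    and mom: "(\<integral>\<^sup>+\<xi>. ennreal (norm \<xi> * cmod (F \<xi>)) \<partial>lborel) \<le> ennreal C"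
    and range: "f \<in> unit_cube \<rightarrow>\<^sub>E {0..1}"
    using f unfolding barron_def by blast
  define d where "d = real CARD('n)"
  have d: "1 \<le> d" by (simp add: d_def Suc_leI)
  \<comment> \<open>The first bound pays for the moment of \<open>\<delta> * H\<close>, keeping the
    total at most \<open>2 * C\<close>; the second keeps the uniform error below
    \<open>\<eta>\<close>.\<close>
  define \<delta> where "\<delta> = min (C / (4 * d)) (\<eta> / (5 * d))"
  have "\<delta> \<le> C / (4 * d)" "\<delta> \<le> \<eta> / (5 * d)" by (auto simp: \<delta>_def)
  then have \<delta>: "4 * d * \<delta> \<le> C" "5 * d * \<delta> \<le> \<eta>"
    using d by (simp_all add: field_simps)
  have \<delta>0: "0 < \<delta>" using \<open>0 < C\<close> \<open>0 < \<eta>\<close> d by (simp add: \<delta>_def)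
  have int: "integrable lborel (\<lambda>\<xi>. norm \<xi> * cmod (F \<xi>))"
    using order_le_less_trans[OF mom ennreal_less_top] by (intro integrableI_bounded) (simp_all add: abs_mult)
  obtain F' where F': "integrable lborel F'" "\<And>\<xi>. cmod (F' \<xi>) \<le> cmod (F \<xi>)"
    and close: "\<And>x. cmod ((\<integral>\<xi>. ?e x \<xi> * F \<xi> \<partial>lborel) - (\<integral>\<xi>. ?e x \<xi> * F' \<xi> \<partial>lborel)) \<le> \<delta> * norm x"
    using high_frequency_part[OF F int \<delta>0] by blast
  obtain H :: "real ^ 'n \<Rightarrow> complex" where H: "integrable lborel H"
    and momH: "(\<integral>\<^sup>+\<xi>. ennreal (norm \<xi> * cmod (H \<xi>)) \<partial>lborel) \<le> ennreal (4 * d)"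
    and cone: "\<And>x. x \<in> unit_cube \<Longrightarrow> norm x \<le> Re (\<integral>\<xi>. ?e x \<xi> * H \<xi> \<partial>lborel)"
      "\<And>x. x \<in> unit_cube \<Longrightarrow> Re (\<integral>\<xi>. ?e x \<xi> * H \<xi> \<partial>lborel) \<le> 4 * d"
    using cone_on_unit_cube[where 'n = 'n, folded d_def] by blast
  have [measurable]: "F' \<in> borel_measurable borel" "H \<in> borel_measurable borel" using F' H by auto
  \<comment> \<open>Before scaling the values reach at most \<open>1 + 5 * d * \<delta>\<close>: the
    truncation error contributes \<open>d * \<delta>\<close>, the added function
    \<open>4 * d * \<delta>\<close>.\<close>
  define s where "s = 1 / (1 + 5 * d * \<delta>)"
  have s: "0 < s" "s \<le> 1" "s * (1 + 5 * d * \<delta>) = 1"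
  proof -
    define q where "q = 5 * d * \<delta>"
    have "0 < q" using d \<delta>0 by (simp add: q_def)
    then show "0 < s" "s \<le> 1" "s * (1 + 5 * d * \<delta>) = 1"
      unfolding s_def q_def[symmetric] by auto
  qed
  define G where "G \<xi> = complex_of_real s * (F' \<xi> + complex_of_real \<delta> * H \<xi>)" for \<xi>
  have G: "integrable lborel G" unfolding G_def using F' H by simp
  then have [measurable]: "G \<in> borel_measurable borel" by simp
  define R where "R x = Re (\<integral>\<xi>. ?e x \<xi> * F' \<xi> \<partial>lborel)" for x
  define h where "h x = Re (\<integral>\<xi>. ?e x \<xi> * H \<xi> \<partial>lborel)" for x
  define g where "g x = s * c + Re (\<integral>\<xi>. ?e x \<xi> * G \<xi> \<partial>lborel)" for x
  have Re_lin: "Re (complex_of_real a * z + complex_of_real b * w) = a * Re z + b * Re w" for a b z w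
    by simp
  have g_eq: "g x = s * (c + R x + \<delta> * h x)" for x
  proof -
    have "(\<integral>\<xi>. ?e x \<xi> * G \<xi> \<partial>lborel)
      = (\<integral>\<xi>. complex_of_real s * (?e x \<xi> * F' \<xi>) + complex_of_real (s * \<delta>) * (?e x \<xi> * H \<xi>) \<partial>lborel)"
      by (intro Bochner_Integration.integral_cong refl) (simp add: G_def algebra_simps)
    also have "\<dots> = complex_of_real s * (\<integral>\<xi>. ?e x \<xi> * F' \<xi> \<partial>lborel) + complex_of_real (s * \<delta>) * (\<integral>\<xi>. ?e x \<xi> * H \<xi> \<partial>lborel)"
      using integrable_exp_ii_minus_1[OF H, of x] integrable_exp_ii_minus_1[OF F'(1), of x]
      by (subst Bochner_Integration.integral_add) auto
    finally have "Re (\<integral>\<xi>. ?e x \<xi> * G \<xi> \<partial>lborel) = s * R x + s * \<delta> * h x"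
      by (simp only: Re_lin R_def h_def)
    then show ?thesis by (simp add: g_def distrib_left)
  qed
  have fg: "0 \<le> g x" "g x \<le> 1" "\<bar>g x - f x\<bar> \<le> \<eta>" if x: "x \<in> unit_cube" for x
  proof -
    \<comment> \<open>The error before scaling. It is nonnegative because
      \<open>\<delta> * h x\<close> dominates the truncation error
      \<open>\<delta> * norm x\<close>.\<close>
    define e where "e = c + R x + \<delta> * h x - f x"
    have e: "g x = s * (f x + e)" by (simp add: e_def g_eq)
    have "f x - (c + R x) = Re ((\<integral>\<xi>. ?e x \<xi> * F \<xi> \<partial>lborel) - (\<integral>\<xi>. ?e x \<xi> * F' \<xi> \<partial>lborel))"
      using arg_cong[OF rep[OF x], of Re] by (simp add: R_def)
    then have "\<bar>f x - (c + R x)\<bar> \<le> \<delta> * norm x"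
      by (simp only: order_trans[OF abs_Re_le_cmod close])
    moreover have "\<delta> * norm x \<le> \<delta> * h x" "\<delta> * h x \<le> \<delta> * (4 * d)"
      using cone[OF x] \<delta>0 by (auto simp: h_def)
    moreover have "norm x \<le> (\<Sum>i\<in>(UNIV::'n set). 1)"
      using x by (intro order_trans[OF norm_le_l1_cart] sum_mono) (simp add: unit_cube_nth)
    then have "\<delta> * norm x \<le> \<delta> * d" using \<delta>0 by (simp add: d_def)
    moreover have "\<delta> * (4 * d) = 4 * (\<delta> * d)" "5 * d * \<delta> = 5 * (\<delta> * d)" by simp_all
    ultimately have e0: "0 \<le> e" "e \<le> 5 * d * \<delta>" unfolding e_def by linarith+
    have fx: "0 \<le> f x" "f x \<le> 1" using PiE_mem[OF range x] by auto
    show "0 \<le> g x" using e e0 fx s by simp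
    have "s * (f x + e) \<le> s * (1 + 5 * d * \<delta>)" using e0 fx s by (intro mult_left_mono) auto
    then show "g x \<le> 1" using s by (simp add: e)
    \<comment> \<open>Written this way, the error is \<open>s\<close> times a difference of two
      numbers in \<open>[0, 5 * d * \<delta>]\<close>, so it does not exceed that length.\<close>
    have "f x = s * (1 + 5 * d * \<delta>) * f x" using s by simp
    then have "g x - f x = s * (e - 5 * d * \<delta> * f x)" unfolding e by (simp add: algebra_simps)
    moreover have "0 \<le> 5 * d * \<delta> * f x" "5 * d * \<delta> * f x \<le> 5 * d * \<delta> * 1"
      using fx d \<delta>0 by (intro mult_nonneg_nonneg mult_left_mono; simp)+
    then have "\<bar>e - 5 * d * \<delta> * f x\<bar> \<le> 5 * d * \<delta>" using e0 by linarith
    then have "s * \<bar>e - 5 * d * \<delta> * f x\<bar> \<le> 1 * (5 * d * \<delta>)"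
      using s by (intro mult_mono) auto
    ultimately show "\<bar>g x - f x\<bar> \<le> \<eta>" using s \<delta>(2) by (simp add: abs_mult)
  qed
  have "restrict g unit_cube \<in> general_barron C"
  proof (rule general_barron_fourier[where F = G and c = "s * c"])
    have "\<bar>s * c\<bar> \<le> 1 * C" unfolding abs_mult using s c by (intro mult_mono) auto
    then show "s * c \<in> {- C..C}" by auto
    have "(\<integral>\<^sup>+\<xi>. ennreal (norm \<xi> * cmod (G \<xi>)) \<partial>lborel)
      \<le> (\<integral>\<^sup>+\<xi>. ennreal (norm \<xi> * cmod (F \<xi>)) + ennreal \<delta> * ennreal (norm \<xi> * cmod (H \<xi>)) \<partial>lborel)"
    proof (rule nn_integral_mono)
      fix \<xi>
      have "cmod (G \<xi>) \<le> cmod (F' \<xi> + complex_of_real \<delta> * H \<xi>)"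
        unfolding G_def norm_mult using s by (simp add: mult_left_le_one_le)
      also have "\<dots> \<le> cmod (F \<xi>) + \<delta> * cmod (H \<xi>)"
        using \<delta>0 F'(2)[of \<xi>] norm_triangle_ineq[of "F' \<xi>" "complex_of_real \<delta> * H \<xi>"] by (simp add: norm_mult)
      finally have "norm \<xi> * cmod (G \<xi>) \<le> norm \<xi> * (cmod (F \<xi>) + \<delta> * cmod (H \<xi>))"
        by (intro mult_left_mono) auto
      then have "norm \<xi> * cmod (G \<xi>) \<le> norm \<xi> * cmod (F \<xi>) + \<delta> * (norm \<xi> * cmod (H \<xi>))"
        by (simp add: algebra_simps)
      from ennreal_leI[OF this]
      show "ennreal (norm \<xi> * cmod (G \<xi>)) \<le> ennreal (norm \<xi> * cmod (F \<xi>)) + ennreal \<delta> * ennreal (norm \<xi> * cmod (H \<xi>))"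
        using \<delta>0 by (simp add: ennreal_plus ennreal_mult)
    qed
    also have "\<dots> = (\<integral>\<^sup>+\<xi>. ennreal (norm \<xi> * cmod (F \<xi>)) \<partial>lborel) + ennreal \<delta> * (\<integral>\<^sup>+\<xi>. ennreal (norm \<xi> * cmod (H \<xi>)) \<partial>lborel)"
      by (simp add: nn_integral_add nn_integral_cmult)
    also have "\<dots> \<le> ennreal C + ennreal \<delta> * ennreal (4 * d)"
      by (intro add_mono mom mult_left_mono momH) simp
    also have "\<dots> = ennreal (C + \<delta> * (4 * d))"
      using d \<delta>0 \<open>0 < C\<close> by (simp add: ennreal_plus ennreal_mult)
    also have "\<dots> \<le> ennreal (2 * pi * C)"
    proof (rule ennreal_leI)
      have "1 * C \<le> pi * C" using \<open>0 < C\<close> pi_gt3 by (intro mult_right_mono) auto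
      then show "C + \<delta> * (4 * d) \<le> 2 * pi * C" using \<delta>(1) by (simp add: mult.commute)
    qed
    finally show "(\<integral>\<^sup>+\<xi>. ennreal (norm \<xi> * cmod (G \<xi>)) \<partial>lborel) \<le> ennreal (2 * pi * C)" .
    show "restrict g unit_cube x = s * c + Re (\<integral>\<xi>. ?e x \<xi> * G \<xi> \<partial>lborel)" if "x \<in> unit_cube" for x
      using that by (simp only: restrict_apply' g_def)
  qed (use G in simp_all)
  moreover have "set_integrable lborel unit_cube (restrict g unit_cube)"
  proof (rule set_integrable_unit_cube[where g = g])
    show "g \<in> borel_measurable borel"
      unfolding g_def[abs_def] using barron_integral_measurable[of G] by simp
  qed (simp_all add: fg)
  moreover from calculation(1) have "restrict g unit_cube \<in> general_barron_star C"
    unfolding general_barron_star_def using fg(1,2) by simp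
  ultimately show ?thesis
    using fg(3) by (intro that[of "restrict g unit_cube"]) simp_all
qed

section \<open>Transfer of packings under uniform approximation\<close>

lemma L1_dist_le_perturb:
  fixes f g f' g' :: "real ^ 'n \<Rightarrow> real"
  assumes int: "set_integrable lborel unit_cube f" "set_integrable lborel unit_cube g"
      "set_integrable lborel unit_cube f'" "set_integrable lborel unit_cube g'"
    and close: "\<And>x. x \<in> unit_cube \<Longrightarrow> \<bar>f' x - f x\<bar> \<le> \<eta>" "\<And>x. x \<in> unit_cube \<Longrightarrow> \<bar>g' x - g x\<bar> \<le> \<eta>"
  shows "L1_dist f g \<le> L1_dist f' g' + 2 * \<eta>"
proof -
  have cube: "emeasure lborel (unit_cube :: (real ^ 'n) set) = 1"
    using content_cbox_cart[of 0 "1 :: real ^ 'n"] emeasure_eq_ennreal_measure[of lborel "unit_cube :: (real ^ 'n) set"]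
    by (simp add: interval_eq_empty_cart emeasure_lborel_cbox_eq)
  then have const: "set_integrable lborel (unit_cube :: (real ^ 'n) set) (\<lambda>x. 2 * \<eta>)"
    unfolding set_integrable_def by simp
  have diff: "set_integrable lborel unit_cube (\<lambda>x. \<bar>f' x - g' x\<bar>)"
    using set_integral_diff(1)[OF int(3,4)] by (rule set_integrable_abs)
  have "L1_dist f g \<le> (LINT x:unit_cube|lborel. \<bar>f' x - g' x\<bar> + 2 * \<eta>)"
    unfolding L1_dist_def
  proof (rule set_integral_mono)
    show "set_integrable lborel unit_cube (\<lambda>x. \<bar>f x - g x\<bar>)"
      using set_integral_diff(1)[OF int(1,2)] by (rule set_integrable_abs)
    show "\<bar>f x - g x\<bar> \<le> \<bar>f' x - g' x\<bar> + 2 * \<eta>" if "x \<in> unit_cube" for x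
      using close[OF that] by linarith
  qed (use set_integral_add(1)[OF diff const] in simp)
  also have "\<dots> = L1_dist f' g' + (LINT x:unit_cube|(lborel :: (real ^ 'n) measure). 2 * \<eta>)"
    unfolding L1_dist_def by (rule set_integral_add(2)[OF diff const])
  also have "(LINT x:unit_cube|(lborel :: (real ^ 'n) measure). 2 * \<eta>) = 2 * \<eta>"
    using cube by (simp add: set_lebesgue_integral_def measure_def)
  finally show ?thesis .
qed

lemma packing_entropy_mono:
  assumes "K \<subseteq> K'"
  shows "packing_entropy K dst \<epsilon> \<le> packing_entropy K' dst \<epsilon>"
  unfolding packing_entropy_def using assms
  by (intro SUP_subset_mono) (auto simp: packing_set_def)

lemma packing_entropy_barron_le:
  assumes "0 < C" "0 < \<epsilon>"
  shows "packing_entropy (barron C :: (real ^ 'n \<Rightarrow> real) set) L1_dist \<epsilon>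
    \<le> packing_entropy (general_barron_star C :: (real ^ 'n \<Rightarrow> real) set) L1_dist \<epsilon>"
  unfolding packing_entropy_def
proof (rule SUP_mono)
  fix P :: "(real ^ 'n \<Rightarrow> real) set"
  assume "P \<in> {N. packing_set (barron C) L1_dist \<epsilon> N \<and> finite N \<and> N \<noteq> {}}"
  then have P: "P \<subseteq> barron C" "finite P" "P \<noteq> {}"
    and sep: "\<And>f g. f \<in> P \<Longrightarrow> g \<in> P \<Longrightarrow> f \<noteq> g \<Longrightarrow> \<epsilon> < L1_dist f g"
    by (auto simp: packing_set_def)
  \<comment> \<open>The slacks of all pairs. The element 1 keeps the set nonempty when
    \<open>P\<close> is a singleton.\<close>
  define D where "D = insert 1 ((\<lambda>(f, g). L1_dist f g - \<epsilon>) ` {(f, g) \<in> P \<times> P. f \<noteq> g})"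
  have D: "finite D" "D \<noteq> {}" "\<forall>t\<in>D. 0 < t"
  proof -
    have "finite {(f, g) \<in> P \<times> P. f \<noteq> g}"
      by (rule finite_subset[of _ "P \<times> P"]) (use P(2) in auto)
    then show "finite D" "D \<noteq> {}" unfolding D_def by simp_all
    show "\<forall>t\<in>D. 0 < t" unfolding D_def using sep by auto
  qed
  define \<eta> where "\<eta> = Min D / 4"
  have \<eta>: "0 < \<eta>" using D by (simp add: \<eta>_def)
  have gap: "\<epsilon> + 2 * \<eta> < L1_dist f g" if "f \<in> P" "g \<in> P" "f \<noteq> g" for f g
  proof -
    have "L1_dist f g - \<epsilon> \<in> D" using that by (auto simp: D_def)
    then have "4 * \<eta> \<le> L1_dist f g - \<epsilon>" using D(1) by (simp add: \<eta>_def)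
    then show ?thesis using \<eta> by simp
  qed
  have "\<exists>f'. f' \<in> general_barron_star C \<and> set_integrable lborel unit_cube f' \<and> (\<forall>x\<in>unit_cube. \<bar>f' x - f x\<bar> \<le> \<eta>)"
    if "f \<in> P" for f
    by (rule barron_approx[OF assms(1) subsetD[OF P(1) that] \<eta>]) blast
  then obtain a where a: "\<And>f. f \<in> P \<Longrightarrow> a f \<in> general_barron_star C"
    "\<And>f. f \<in> P \<Longrightarrow> set_integrable lborel unit_cube (a f)"
    "\<And>f x. f \<in> P \<Longrightarrow> x \<in> unit_cube \<Longrightarrow> \<bar>a f x - f x\<bar> \<le> \<eta>"
    by metis
  have gap': "\<epsilon> < L1_dist (a f) (a g)" if "f \<in> P" "g \<in> P" "f \<noteq> g" for f g
  proof -
    have "L1_dist f g \<le> L1_dist (a f) (a g) + 2 * \<eta>"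
      using that P(1) a by (intro L1_dist_le_perturb[OF set_integrable_barron[of _ C] set_integrable_barron[of _ C]]) auto
    then show ?thesis using gap[OF that] by simp
  qed
  \<comment> \<open>Coinciding approximants would have distance 0, contradicting the separation by
    \<open>\<epsilon>\<close>.\<close>
  have "inj_on a P"
  proof (rule inj_onI, rule ccontr)
    fix f g assume "f \<in> P" "g \<in> P" "a f = a g" "f \<noteq> g"
    then show False using gap'[of f g] assms(2) by (simp add: L1_dist_def)
  qed
  then have "card (a ` P) = card P" by (rule card_image)
  moreover have "packing_set (general_barron_star C) L1_dist \<epsilon> (a ` P)"
    unfolding packing_set_def
  proof (intro conjI ballI impI)
    fix u v assume "u \<in> a ` P" "v \<in> a ` P" "u \<noteq> v"
    then obtain f g where "f \<in> P" "g \<in> P" "u = a f" "v = a g" "f \<noteq> g" by blast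
    then show "\<epsilon> < L1_dist u v" using gap' by simp
  qed (use a(1) in blast)
  ultimately have "a ` P \<in> {N. packing_set (general_barron_star C) L1_dist \<epsilon> N \<and> finite N \<and> N \<noteq> {}}"
    and "ereal (ln (real (card P))) \<le> ereal (ln (real (card (a ` P))))"
    using P by simp_all
  then show "\<exists>N\<in>{N :: (real ^ 'n \<Rightarrow> real) set. packing_set (general_barron_star C) L1_dist \<epsilon> N \<and> finite N \<and> N \<noteq> {}}.
      ereal (ln (real (card P))) \<le> ereal (ln (real (card N)))"
    by (rule rev_bexI)
qed

subsection \<open>Packings of Barron functions\<close>

text \<open>Chebyshev's inequality with the second moment
  \<open>real DIM('a) * \<tau>\<^sup>2\<close>.\<close>

lemma gauss_concentration:
  fixes a :: "'a::euclidean_space"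
  assumes "0 < \<tau>" "0 < r"
  shows "integrable lborel (\<lambda>x. gauss \<tau> (x - a))"
    and "(\<integral>x. gauss \<tau> (x - a) \<partial>lborel) = 1"
    and "1 - real DIM('a) * \<tau>\<^sup>2 / r\<^sup>2 \<le> (\<integral>x. indicator (ball a r) x * gauss \<tau> (x - a) \<partial>lborel)"
proof -
  have distr: "distr lborel borel (\<lambda>x. x - a) = (lborel :: 'a measure)"
    using lborel_affine[of 1 "- a"] by (simp add: density_1)
  have shift: "integrable lborel (\<lambda>x. h (x - a)) \<longleftrightarrow> integrable lborel h"
    "(\<integral>x. h (x - a) \<partial>lborel) = (\<integral>x. h x \<partial>lborel)" if "h \<in> borel_measurable borel" for h :: "'a \<Rightarrow> real"
    using that integrable_distr_eq[of "\<lambda>x. x - a" lborel borel h] integral_distr[of "\<lambda>x. x - a" lborel borel h]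
    by (simp_all add: distr)
  show int: "integrable lborel (\<lambda>x. gauss \<tau> (x - a))" and one: "(\<integral>x. gauss \<tau> (x - a) \<partial>lborel) = 1"
    using shift[of "gauss \<tau>"] assms(1) by (simp_all add: integrable_gauss integral_gauss)
  let ?q = "\<lambda>x. (norm x)\<^sup>2 * gauss \<tau> x"
  have q: "integrable lborel (\<lambda>x. ?q (x - a))" "(\<integral>x. ?q (x - a) \<partial>lborel) = real DIM('a) * \<tau>\<^sup>2"
    using shift[of ?q] gauss_second_moment[OF assms(1), where 'a = 'a] by (simp_all add: has_bochner_integral_iff)
  have "1 - real DIM('a) * \<tau>\<^sup>2 / r\<^sup>2 = (\<integral>x. gauss \<tau> (x - a) - ?q (x - a) / r\<^sup>2 \<partial>lborel)"
    using int one q by simp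
  also have "\<dots> \<le> (\<integral>x. indicator (ball a r) x * gauss \<tau> (x - a) \<partial>lborel)"
  proof (rule integral_mono)
    show "integrable lborel (\<lambda>x. gauss \<tau> (x - a) - ?q (x - a) / r\<^sup>2)" using int q by simp
    show "integrable lborel (\<lambda>x. indicator (ball a r) x * gauss \<tau> (x - a))"
      using integrable_mult_indicator[OF _ int, of "ball a r"] by simp
    fix x
    show "gauss \<tau> (x - a) - ?q (x - a) / r\<^sup>2 \<le> indicator (ball a r) x * gauss \<tau> (x - a)"
    proof (cases "x \<in> ball a r")
      case True
      then show ?thesis by (simp add: gauss_nonneg)
    next
      case False
      then have "r \<le> norm (x - a)" by (simp add: dist_norm norm_minus_commute)
      then have "r\<^sup>2 \<le> (norm (x - a))\<^sup>2" using assms(2) by (intro power_mono) auto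
      then have "r\<^sup>2 * gauss \<tau> (x - a) \<le> ?q (x - a)" by (intro mult_right_mono gauss_nonneg)
      then show ?thesis using False assms(2) by (simp add: field_simps)
    qed
  qed
  finally show "1 - real DIM('a) * \<tau>\<^sup>2 / r\<^sup>2 \<le> (\<integral>x. indicator (ball a r) x * gauss \<tau> (x - a) \<partial>lborel)" .
qed

text \<open>
  Duality: \<open>w\<close> is a bounded test function of mean zero, so it does not see the constant \<open>t\<close>, and
  it equals the sign \<open>s k\<close> where the bump \<open>\<phi> k\<close> has most of its mass.
\<close>

lemma L1_lower_bound_bumps:
  fixes \<phi> :: "'k \<Rightarrow> 'a::euclidean_space \<Rightarrow> real" and s :: "'k \<Rightarrow> real"
  assumes K: "finite K" and "0 \<le> \<beta>"
    and \<phi>: "\<And>k. k \<in> K \<Longrightarrow> integrable lborel (\<phi> k)" "\<And>k x. 0 \<le> \<phi> k x"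
      "\<And>k. k \<in> K \<Longrightarrow> (\<integral>x. \<phi> k x \<partial>lborel) = T"
      "\<And>k. k \<in> K \<Longrightarrow> 3 / 4 * T \<le> (\<integral>x. indicator (A k) x * \<phi> k x \<partial>lborel)"
    and A [measurable]: "\<And>k. A k \<in> sets borel"
    and w: "integrable lborel w" "(\<integral>x. w x \<partial>lborel) = 0" "\<And>x. \<bar>w x\<bar> \<le> 1" "\<And>x. x \<notin> Q \<Longrightarrow> w x = 0"
      "\<And>k x. k \<in> K \<Longrightarrow> x \<in> A k \<Longrightarrow> w x = s k"
    and s: "\<And>k. k \<in> K \<Longrightarrow> s k \<in> {- 1, 0, 1}"
    and g: "\<And>x. x \<in> Q \<Longrightarrow> g x = t + (\<Sum>k\<in>K. 2 * \<beta> * s k * \<phi> k x)" "set_integrable lborel Q g"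
  shows "\<beta> * T * real (card {k \<in> K. s k \<noteq> 0}) \<le> (LINT x:Q|lborel. \<bar>g x\<bar>)"
proof -
  have \<phi>m [measurable]: "\<phi> k \<in> borel_measurable borel" if "k \<in> K" for k using \<phi>(1)[OF that] by simp
  have wm [measurable]: "w \<in> borel_measurable borel" using w(1) by simp
  have int: "integrable lborel (\<lambda>x. \<phi> k x * w x)" if "k \<in> K" for k
  proof (rule Bochner_Integration.integrable_bound[OF \<phi>(1)[OF that]])
    show "AE x in lborel. norm (\<phi> k x * w x) \<le> norm (\<phi> k x)"
      using w(3) by (intro AE_I2) (simp add: abs_mult mult_left_le)
  qed (use that in measurable)
  have each: "T / 2 * (s k)\<^sup>2 \<le> s k * (\<integral>x. \<phi> k x * w x \<partial>lborel)" if k: "k \<in> K" for k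
  proof (cases "s k = 0")
    case False
    then have sk: "s k = 1 \<or> s k = - 1" using s[OF k] by auto
    have intA: "integrable lborel (\<lambda>x. indicator (A k) x * \<phi> k x)"
      using integrable_mult_indicator[OF _ \<phi>(1)[OF k], of "A k"] by simp
    \<comment> \<open>The worst case is \<open>w = - s k\<close> off \<open>A k\<close>: at least
      \<open>3 / 4 * T\<close> is gained on \<open>A k\<close> and at most \<open>T / 4\<close> lost
      elsewhere.\<close>
    have "T / 2 \<le> 2 * (\<integral>x. indicator (A k) x * \<phi> k x \<partial>lborel) - (\<integral>x. \<phi> k x \<partial>lborel)"
      using \<phi>(3,4)[OF k] by linarith
    also have "\<dots> = (\<integral>x. 2 * (indicator (A k) x * \<phi> k x) - \<phi> k x \<partial>lborel)"
      using intA \<phi>(1)[OF k] by simp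
    also have "\<dots> \<le> (\<integral>x. s k * (\<phi> k x * w x) \<partial>lborel)"
    proof (rule integral_mono)
      fix x
      show "2 * (indicator (A k) x * \<phi> k x) - \<phi> k x \<le> s k * (\<phi> k x * w x)"
      proof (cases "x \<in> A k")
        case True
        then show ?thesis using w(5)[OF k True] sk by auto
      next
        case False
        have "- 1 \<le> s k * w x" using w(3)[of x] sk by (auto simp: abs_le_iff)
        then have "\<phi> k x * (- 1) \<le> \<phi> k x * (s k * w x)" using \<phi>(2) by (intro mult_left_mono)
        then show ?thesis using False by (simp add: mult_ac)
      qed
    qed (use intA \<phi>(1)[OF k] int[OF k] in simp_all)
    finally show ?thesis using sk by auto
  qed simp
  have "\<beta> * T * real (card {k \<in> K. s k \<noteq> 0}) = (\<Sum>k\<in>{k \<in> K. s k \<noteq> 0}. 2 * \<beta> * (T / 2 * (s k)\<^sup>2))"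
  proof -
    have "(\<Sum>k\<in>{k \<in> K. s k \<noteq> 0}. 2 * \<beta> * (T / 2 * (s k)\<^sup>2)) = (\<Sum>k\<in>{k \<in> K. s k \<noteq> 0}. \<beta> * T)"
      using s by (intro sum.cong refl) fastforce
    then show ?thesis by simp
  qed
  also have "\<dots> = (\<Sum>k\<in>K. 2 * \<beta> * (T / 2 * (s k)\<^sup>2))"
    using K by (intro sum.mono_neutral_left) auto
  also have "\<dots> \<le> (\<Sum>k\<in>K. 2 * \<beta> * (s k * (\<integral>x. \<phi> k x * w x \<partial>lborel)))"
    using each \<open>0 \<le> \<beta>\<close> by (intro sum_mono mult_left_mono) auto
  also have "\<dots> = (\<integral>x. t * w x + (\<Sum>k\<in>K. 2 * \<beta> * s k * (\<phi> k x * w x)) \<partial>lborel)"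
    using int w(1,2) by (simp add: mult.assoc)
  also have "\<dots> \<le> (\<integral>x. indicator Q x *\<^sub>R \<bar>g x\<bar> \<partial>lborel)"
  proof (rule integral_mono)
    show "integrable lborel (\<lambda>x. t * w x + (\<Sum>k\<in>K. 2 * \<beta> * s k * (\<phi> k x * w x)))"
      using int w(1) by simp
    show "integrable lborel (\<lambda>x. indicator Q x *\<^sub>R \<bar>g x\<bar>)"
      using set_integrable_abs[OF g(2)] by (simp only: set_integrable_def)
    fix x
    have "t * w x + (\<Sum>k\<in>K. 2 * \<beta> * s k * (\<phi> k x * w x)) = (t + (\<Sum>k\<in>K. 2 * \<beta> * s k * \<phi> k x)) * w x"
      by (simp add: distrib_right sum_distrib_right mult.assoc)
    also have "\<dots> \<le> indicator Q x *\<^sub>R \<bar>g x\<bar>"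
    proof (cases "x \<in> Q")
      case True
      have "g x * w x \<le> \<bar>g x\<bar> * \<bar>w x\<bar>" by (metis abs_ge_self abs_mult)
      also have "\<dots> \<le> \<bar>g x\<bar> * 1" using w(3) by (intro mult_left_mono) auto
      finally show ?thesis using True g(1)[OF True] by simp
    qed (simp add: w(4))
    finally show "t * w x + (\<Sum>k\<in>K. 2 * \<beta> * s k * (\<phi> k x * w x)) \<le> indicator Q x *\<^sub>R \<bar>g x\<bar>" .
  qed
  finally show ?thesis by (simp only: set_lebesgue_integral_def)
qed

section \<open>Grid geometry and signed bump sums\<close>

lemma balls_disjoint_coordinate:
  fixes p q :: "real ^ 'n"
  assumes "2 * r \<le> \<bar>p $ i - q $ i\<bar>"
  shows "ball p r \<inter> ball q r = {}"
proof (rule ccontr)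
  assume "ball p r \<inter> ball q r \<noteq> {}"
  then obtain x where "dist p x < r" "dist q x < r" by auto
  moreover have "\<bar>p $ i - x $ i\<bar> \<le> dist p x" "\<bar>q $ i - x $ i\<bar> \<le> dist q x"
    using component_le_norm_cart[of "p - x" i] component_le_norm_cart[of "q - x" i] by (simp_all add: dist_norm)
  ultimately show False using assms by linarith
qed

text \<open>The offset \<open>\<theta>\<close> is the relative position inside the cell
  \<open>k\<close> of side \<open>1 / m\<close>: \<open>1 / 4\<close> for the centre of a bump,
  \<open>3 / 4\<close> for a second ball that balances the mean of the test function.\<close>

definition grid_point :: "nat \<Rightarrow> real \<Rightarrow> ('n \<Rightarrow> nat) \<Rightarrow> real ^ 'n" where
  "grid_point m \<theta> k = (\<chi> i. (real (k i) + \<theta>) / real m)"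

text \<open>In some coordinate either the cell indices agree and the offsets differ by
  \<open>1 / 2\<close>, or the indices differ by at least 1 and the offsets take back at most
  \<open>1 / 2\<close>. After division by \<open>m\<close> this is twice the radius.\<close>

lemma grid_balls_disjoint:
  fixes k l :: "'n::finite \<Rightarrow> nat"
  assumes m: "0 < m" and \<theta>: "\<theta> \<in> {1 / 4, 3 / 4}" "\<theta>' \<in> {1 / 4, 3 / 4}" and ne: "(k, \<theta>) \<noteq> (l, \<theta>')"
  shows "ball (grid_point m \<theta> k) (1 / (4 * real m)) \<inter> ball (grid_point m \<theta>' l) (1 / (4 * real m)) = {}"
proof -
  obtain i where "k i \<noteq> l i \<or> \<theta> \<noteq> \<theta>'" using ne by auto
  then have "1 / 2 \<le> \<bar>(real (k i) + \<theta>) - (real (l i) + \<theta>')\<bar>"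
  proof -
    have "k i = l i \<or> real (k i) + 1 \<le> real (l i) \<or> real (l i) + 1 \<le> real (k i)" by linarith
    then show ?thesis using \<theta> \<open>k i \<noteq> l i \<or> \<theta> \<noteq> \<theta>'\<close> by auto
  qed
  then have "1 / 2 / real m \<le> \<bar>(real (k i) + \<theta>) - (real (l i) + \<theta>')\<bar> / \<bar>real m\<bar>"
    using m by (intro frac_le) auto
  then have "2 * (1 / (4 * real m)) \<le> \<bar>grid_point m \<theta> k $ i - grid_point m \<theta>' l $ i\<bar>"
    by (simp only: grid_point_def vec_lambda_beta diff_divide_distrib[symmetric] abs_divide)
  then show ?thesis by (rule balls_disjoint_coordinate)
qed

lemma grid_ball_subset_unit_cube:
  fixes k :: "'n::finite \<Rightarrow> nat"
  assumes m: "0 < m" and \<theta>: "\<theta> \<in> {1 / 4, 3 / 4}" and k: "\<And>i. k i < m"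
  shows "ball (grid_point m \<theta> k) (1 / (4 * real m)) \<subseteq> unit_cube"
proof
  fix x assume x: "x \<in> ball (grid_point m \<theta> k) (1 / (4 * real m))"
  have "0 \<le> x $ i \<and> x $ i \<le> 1" for i
  proof -
    have "\<bar>grid_point m \<theta> k $ i - x $ i\<bar> < 1 / (4 * real m)"
      using x component_le_norm_cart[of "grid_point m \<theta> k - x" i] by (simp add: dist_norm)
    then have "\<bar>(real (k i) + \<theta>) / real m - x $ i\<bar> * real m < 1 / 4"
      using m by (simp add: grid_point_def field_simps)
    moreover have "\<bar>(real (k i) + \<theta>) / real m - x $ i\<bar> * real m = \<bar>(real (k i) + \<theta>) - x $ i * real m\<bar>"
      using m by (simp add: abs_mult_pos left_diff_distrib)
    ultimately have *: "\<bar>(real (k i) + \<theta>) - x $ i * real m\<bar> < 1 / 4" by simp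
    have "real (k i) + 1 \<le> real m" using k[of i] by linarith
    moreover have "1 / 4 \<le> \<theta>" "\<theta> \<le> 3 / 4" using \<theta> by auto
    ultimately have "0 \<le> x $ i * real m" "x $ i * real m \<le> 1 * real m" using * by linarith+
    then show ?thesis using m by (simp add: zero_le_mult_iff)
  qed
  then show "x \<in> unit_cube" by (simp add: unit_cube_nth)
qed

text \<open>In each cell the ball at offset \<open>1 / 4\<close> carries \<open>s k\<close> and the
  ball of equal volume at offset \<open>3 / 4\<close> carries \<open>- s k\<close>. The mean
  vanishes cell by cell, and disjointness of all the balls bounds the sum by 1.\<close>

lemma exists_sign_test_function:
  fixes s :: "('n::finite \<Rightarrow> nat) \<Rightarrow> real"
  assumes m: "0 < m" and s: "\<And>k. \<bar>s k\<bar> \<le> 1"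
  shows "\<exists>w :: real ^ 'n \<Rightarrow> real. integrable lborel w \<and> (\<integral>x. w x \<partial>lborel) = 0 \<and> (\<forall>x. \<bar>w x\<bar> \<le> 1)
    \<and> (\<forall>x. x \<notin> unit_cube \<longrightarrow> w x = 0)
    \<and> (\<forall>k\<in>UNIV \<rightarrow> {..<m}. \<forall>x\<in>ball (grid_point m (1 / 4) k) (1 / (4 * real m)). w x = s k)"
proof -
  let ?K = "UNIV \<rightarrow> {..<m} :: ('n \<Rightarrow> nat) set"
  have finK: "finite ?K" using finite_PiE[of "UNIV :: 'n set" "\<lambda>_. {..<m}"] by (simp add: PiE_UNIV_domain)
  define B where "B \<theta> k = ball (grid_point m \<theta> k :: real ^ 'n) (1 / (4 * real m))" for \<theta> k
  have disj: "x \<notin> B \<theta>' l" if "x \<in> B \<theta> k" "\<theta> \<in> {1 / 4, 3 / 4}" "\<theta>' \<in> {1 / 4, 3 / 4}" "(k, \<theta>) \<noteq> (l, \<theta>')" for x k l \<theta> \<theta>'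
    using grid_balls_disjoint[OF m that(2-4)] that(1) by (auto simp: B_def)
  define w where "w x = (\<Sum>k\<in>?K. s k * (indicator (B (1 / 4) k) x - indicator (B (3 / 4) k) x))" for x
  have w1: "w x = s k" if "k \<in> ?K" "x \<in> B (1 / 4) k" for x k
  proof -
    have "w x = (\<Sum>l\<in>?K. if l = k then s k else 0)"
      unfolding w_def using disj[OF that(2)] that(2) by (intro sum.cong refl) (auto simp: indicator_def)
    then show ?thesis using that(1) finK by simp
  qed
  have w2: "w x = - s k" if "k \<in> ?K" "x \<in> B (3 / 4) k" for x k
  proof -
    have "w x = (\<Sum>l\<in>?K. if l = k then - s k else 0)"
      unfolding w_def using disj[OF that(2)] that(2) by (intro sum.cong refl) (auto simp: indicator_def)
    then show ?thesis using that(1) finK by simp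
  qed
  have w3: "w x = 0" if "\<And>k. k \<in> ?K \<Longrightarrow> x \<notin> B (1 / 4) k \<and> x \<notin> B (3 / 4) k" for x
    unfolding w_def using that by (intro sum.neutral) simp
  have "\<bar>w x\<bar> \<le> 1" for x
    using w1[of _ x] w2[of _ x] w3[of x] s by (metis abs_minus_cancel abs_zero zero_le_one)
  moreover have "w x = 0" if "x \<notin> unit_cube" for x
  proof (rule w3)
    fix k assume "k \<in> ?K"
    then have k: "k i < m" for i by auto
    have "B \<theta> k \<subseteq> unit_cube" if "\<theta> \<in> {1 / 4, 3 / 4}" for \<theta>
      unfolding B_def by (rule grid_ball_subset_unit_cube[OF m that k])
    then show "x \<notin> B (1 / 4) k \<and> x \<notin> B (3 / 4) k" using \<open>x \<notin> unit_cube\<close> by blast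
  qed
  moreover have intB: "integrable lborel (indicator (B \<theta> k) :: _ \<Rightarrow> real)" for \<theta> k
    unfolding B_def by (intro integrable_real_indicator emeasure_bounded_finite) auto
  then have "integrable lborel w" unfolding w_def by simp
  moreover have "(\<integral>x. w x \<partial>lborel) = 0"
    unfolding w_def using intB m by (simp add: B_def content_ball)
  ultimately show ?thesis using w1 by (intro exI[of _ w]) (simp add: B_def)
qed

text \<open>The density is a Gaussian times the exponential sum with frequencies
  \<open>- z k\<close>; multiplication by a character translates the bump. The one hypothesis
  \<open>mom\<close> serves twice: it bounds the moment by \<open>C\<close>, and, as
  \<open>norm x\<close> is at most the dimension on the cube, it confines the deviation from the
  constant to \<open>min C 1 / 2\<close>, so that the values lie in \<open>[0, 1]\<close>.\<close>

lemma bump_sum_in_barron: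
  fixes z :: "'k \<Rightarrow> real ^ 'n" and s :: "'k \<Rightarrow> real"
  assumes "0 < C" "0 < \<sigma>" "0 \<le> \<beta>" and K: "finite K"
    and mom: "\<beta> * (\<integral>\<eta>. norm \<eta> * gauss \<sigma> \<eta> * cmod (\<Sum>k\<in>K. s k *\<^sub>R exp (\<i> * complex_of_real (- z k \<bullet> \<eta>))) \<partial>lborel)
      \<le> min C 1 / (2 * real CARD('n))"
  shows "(\<lambda>x\<in>unit_cube. min C 1 / 2 + (\<Sum>k\<in>K. \<beta> * s k * (exp (- (\<sigma>\<^sup>2 * (norm (x - z k))\<^sup>2) / 2)
      - exp (- (\<sigma>\<^sup>2 * (norm (z k))\<^sup>2) / 2)))) \<in> barron C"
proof -
  define d where "d = real CARD('n)"
  have d: "1 \<le> d" by (simp add: d_def Suc_leI)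
  let ?c = "min C 1 / 2"
  define \<Phi> where "\<Phi> x = exp (- (\<sigma>\<^sup>2 * (norm x)\<^sup>2) / 2)" for x :: "real ^ 'n"
  define E where "E x \<eta> = exp (\<i> * complex_of_real (x \<bullet> \<eta>))" for x \<eta> :: "real ^ 'n"
  define V where "V \<eta> = (\<Sum>k\<in>K. s k *\<^sub>R E (- z k) \<eta>)" for \<eta>
  have [measurable]: "E x \<in> borel_measurable borel" for x unfolding E_def[abs_def] by measurable
  have [measurable]: "V \<in> borel_measurable borel" unfolding V_def[abs_def] by measurable
  define F where "F \<eta> = complex_of_real \<beta> * (V \<eta> * complex_of_real (gauss \<sigma> \<eta>))" for \<eta>
  have [measurable]: "F \<in> borel_measurable borel" unfolding F_def[abs_def] by measurable
  have four: "integrable lborel (\<lambda>\<eta>. E x \<eta> * complex_of_real (gauss \<sigma> \<eta>))"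
    "(\<integral>\<eta>. E x \<eta> * complex_of_real (gauss \<sigma> \<eta>) \<partial>lborel) = complex_of_real (\<Phi> x)" for x
    unfolding E_def \<Phi>_def by (rule fourier_gauss[OF \<open>0 < \<sigma>\<close>])+
  have V_le: "cmod (V \<eta>) \<le> (\<Sum>k\<in>K. \<bar>s k\<bar>)" for \<eta>
    unfolding V_def by (rule sum_norm_le) (simp add: E_def)
  define I where "I = (\<integral>\<eta>. norm \<eta> * gauss \<sigma> \<eta> * cmod (V \<eta>) \<partial>lborel)"
  have I_le: "\<beta> * I \<le> ?c / d" using mom by (simp add: I_def V_def E_def d_def)
  have intI: "integrable lborel (\<lambda>\<eta>. norm \<eta> * gauss \<sigma> \<eta> * cmod (V \<eta>))"
  proof (rule Bochner_Integration.integrable_bound[OF integrable_mult_left[OF gauss_first_moment(1)[OF \<open>0 < \<sigma>\<close>], of "\<Sum>k\<in>K. \<bar>s k\<bar>"]])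
    show "AE \<eta> in lborel. norm (norm \<eta> * gauss \<sigma> \<eta> * cmod (V \<eta>)) \<le> norm (norm \<eta> * gauss \<sigma> \<eta> * (\<Sum>k\<in>K. \<bar>s k\<bar>))"
      using V_le by (intro AE_I2) (simp add: abs_mult gauss_nonneg sum_nonneg mult_left_mono)
  qed measurable
  have F_eq: "norm \<eta> * cmod (F \<eta>) = \<beta> * (norm \<eta> * gauss \<sigma> \<eta> * cmod (V \<eta>))" for \<eta>
    using \<open>0 \<le> \<beta>\<close> by (simp add: F_def norm_mult gauss_nonneg)
  have intF: "integrable lborel (\<lambda>\<eta>. norm \<eta> * cmod (F \<eta>))"
    unfolding F_eq using intI by simp
  have momF: "(\<integral>\<eta>. norm \<eta> * cmod (F \<eta>) \<partial>lborel) \<le> ?c / d"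
    unfolding F_eq using I_le by (simp add: I_def)
  define f where "f x = ?c + (\<Sum>k\<in>K. \<beta> * s k * (\<Phi> (x - z k) - \<Phi> (z k)))" for x
  have rep: "complex_of_real (f x) = complex_of_real ?c + (\<integral>\<eta>. (E x \<eta> - 1) * F \<eta> \<partial>lborel)" for x
  proof -
    have E: "(E x \<eta> - 1) * E (- z k) \<eta> = E (x - z k) \<eta> - E (- z k) \<eta>" for \<eta> k
      by (simp add: E_def inner_diff_left algebra_simps exp_add[symmetric] exp_minus exp_diff divide_inverse)
    have "(E x \<eta> - 1) * F \<eta> = (\<Sum>k\<in>K. complex_of_real (\<beta> * s k) * (E (x - z k) \<eta> * complex_of_real (gauss \<sigma> \<eta>)
        - E (- z k) \<eta> * complex_of_real (gauss \<sigma> \<eta>)))" for \<eta>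
    proof -
      have "(E x \<eta> - 1) * F \<eta> = (\<Sum>k\<in>K. complex_of_real (\<beta> * s k) * (((E x \<eta> - 1) * E (- z k) \<eta>) * complex_of_real (gauss \<sigma> \<eta>)))"
        by (simp add: F_def V_def scaleR_conv_of_real sum_distrib_left sum_distrib_right mult_ac)
      then show ?thesis unfolding E by (simp only: left_diff_distrib)
    qed
    then have "(\<integral>\<eta>. (E x \<eta> - 1) * F \<eta> \<partial>lborel) = (\<Sum>k\<in>K. complex_of_real (\<beta> * s k) * (complex_of_real (\<Phi> (x - z k)) - complex_of_real (\<Phi> (- z k))))"
      using four by simp
    moreover have "\<Phi> (- z k) = \<Phi> (z k)" for k by (simp add: \<Phi>_def)
    ultimately show ?thesis by (simp add: f_def)
  qed
  have "f x \<in> {0..1}" if x: "x \<in> unit_cube" for x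
  proof -
    have "norm x \<le> (\<Sum>i\<in>(UNIV::'n set). 1)"
      using x by (intro order_trans[OF norm_le_l1_cart] sum_mono) (simp add: unit_cube_nth)
    then have nx: "norm x \<le> d" by (simp add: d_def)
    have "complex_of_real (f x - ?c) = (\<integral>\<eta>. (E x \<eta> - 1) * F \<eta> \<partial>lborel)"
      using rep[of x] by simp
    then have "\<bar>f x - ?c\<bar> = cmod (\<integral>\<eta>. (E x \<eta> - 1) * F \<eta> \<partial>lborel)"
      by (metis norm_of_real)
    also have "\<dots> \<le> (\<integral>\<eta>. cmod ((E x \<eta> - 1) * F \<eta>) \<partial>lborel)" by (rule integral_norm_bound)
    also have "\<dots> \<le> (\<integral>\<eta>. norm x * (norm \<eta> * cmod (F \<eta>)) \<partial>lborel)"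
    proof (rule Bochner_Integration.integral_mono')
      show "cmod ((E x \<eta> - 1) * F \<eta>) \<le> norm x * (norm \<eta> * cmod (F \<eta>))" for \<eta>
        unfolding norm_mult mult.assoc[symmetric] E_def
        by (intro mult_right_mono order_trans[OF cmod_exp_ii_minus_1_le_abs Cauchy_Schwarz_ineq2]) simp
    qed (use intF in simp_all)
    also have "\<dots> = norm x * (\<integral>\<eta>. norm \<eta> * cmod (F \<eta>) \<partial>lborel)" by simp
    also have "\<dots> \<le> d * (?c / d)"
      using nx momF d by (intro mult_mono) (auto intro!: integral_nonneg_AE)
    also have "\<dots> = ?c" using d by simp
    finally have "\<bar>f x - ?c\<bar> \<le> ?c" .
    then have "0 \<le> f x" "f x \<le> 2 * ?c" by linarith+
    then show ?thesis by simp
  qed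
  moreover have "(\<integral>\<^sup>+\<eta>. ennreal (norm \<eta> * cmod (F \<eta>)) \<partial>lborel) \<le> ennreal C"
  proof -
    have "(\<integral>\<^sup>+\<eta>. ennreal (norm \<eta> * cmod (F \<eta>)) \<partial>lborel) = ennreal (\<integral>\<eta>. norm \<eta> * cmod (F \<eta>) \<partial>lborel)"
      using intF by (intro nn_integral_eq_integral) auto
    also have "?c / d \<le> ?c / 1" using d \<open>0 < C\<close> by (intro divide_left_mono) auto
    then have "(\<integral>\<eta>. norm \<eta> * cmod (F \<eta>) \<partial>lborel) \<le> C"
      using momF \<open>0 < C\<close> by linarith
    then have "ennreal (\<integral>\<eta>. norm \<eta> * cmod (F \<eta>) \<partial>lborel) \<le> ennreal C" by (rule ennreal_leI)
    finally show ?thesis .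
  qed
  moreover have "?c \<in> {- C..C}" using \<open>0 < C\<close> by auto
  ultimately have "(\<lambda>x\<in>unit_cube. f x) \<in> barron C"
    unfolding barron_def using rep[unfolded E_def] by (intro CollectI conjI exI[of _ F] exI[of _ ?c]) auto
  then show ?thesis by (simp only: f_def \<Phi>_def)
qed

text \<open>Averaging over the signs inside the integral replaces the exponential sum by
  \<open>sqrt (card K)\<close>, leaving the Gaussian first moment; Markov's inequality then accounts
  for the factor 2.\<close>

lemma many_good_signs:
  fixes z :: "'k \<Rightarrow> 'a::euclidean_space"
  assumes "0 < \<sigma>" and K: "finite K" "K \<noteq> {}"
  defines "I \<equiv> \<lambda>S. \<integral>\<eta>. norm \<eta> * gauss \<sigma> \<eta> * cmod (\<Sum>k\<in>K. sgn_of S k *\<^sub>R exp (\<i> * complex_of_real (- z k \<bullet> \<eta>))) \<partial>lborel"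
  shows "2 ^ card K \<le> 2 * card {S \<in> Pow K. I S \<le> 2 * (sqrt (card K) * (real DIM('a) * \<sigma>))}"
proof -
  let ?V = "\<lambda>S \<eta>. \<Sum>k\<in>K. sgn_of S k *\<^sub>R exp (\<i> * complex_of_real (- z k \<bullet> \<eta>))"
  have V_le: "cmod (?V S \<eta>) \<le> (\<Sum>k\<in>K. 1)" for S \<eta>
    by (rule sum_norm_le) (simp add: sgn_of_def)
  have int: "integrable lborel (\<lambda>\<eta>. norm \<eta> * gauss \<sigma> \<eta> * cmod (?V S \<eta>))" for S
  proof (rule Bochner_Integration.integrable_bound[OF integrable_mult_left[OF gauss_first_moment(1)[OF \<open>0 < \<sigma>\<close>], of "\<Sum>k\<in>K. 1"]])
    show "AE \<eta> in lborel. norm (norm \<eta> * gauss \<sigma> \<eta> * cmod (?V S \<eta>)) \<le> norm (norm \<eta> * gauss \<sigma> \<eta> * (\<Sum>k\<in>K. 1))"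
      using V_le[of S] by (intro AE_I2) (simp add: abs_mult gauss_nonneg mult_left_mono)
  qed measurable
  have "(\<Sum>S\<in>Pow K. I S) = (\<integral>\<eta>. (\<Sum>S\<in>Pow K. norm \<eta> * gauss \<sigma> \<eta> * cmod (?V S \<eta>)) \<partial>lborel)"
    unfolding I_def using int by (rule Bochner_Integration.integral_sum[symmetric])
  also have "\<dots> \<le> (\<integral>\<eta>. norm (\<eta> :: 'a) * gauss \<sigma> \<eta> * (2 ^ card K * sqrt (card K)) \<partial>lborel)"
  proof (rule integral_mono)
    show "integrable lborel (\<lambda>\<eta>. \<Sum>S\<in>Pow K. norm \<eta> * gauss \<sigma> \<eta> * cmod (?V S \<eta>))" using int by simp
    show "integrable lborel (\<lambda>\<eta>::'a. norm \<eta> * gauss \<sigma> \<eta> * (2 ^ card K * sqrt (card K)))"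
      by (intro integrable_mult_left gauss_first_moment(1) \<open>0 < \<sigma>\<close>)
    show "(\<Sum>S\<in>Pow K. norm \<eta> * gauss \<sigma> \<eta> * cmod (?V S \<eta>)) \<le> norm \<eta> * gauss \<sigma> \<eta> * (2 ^ card K * sqrt (card K))" for \<eta>
      unfolding sum_distrib_left[symmetric]
      by (intro mult_left_mono sum_signs_norm_le K mult_nonneg_nonneg gauss_nonneg) simp_all
  qed
  also have "\<dots> = (\<integral>\<eta>. norm (\<eta> :: 'a) * gauss \<sigma> \<eta> \<partial>lborel) * (2 ^ card K * sqrt (card K))" by simp
  also have "\<dots> \<le> real DIM('a) * \<sigma> * (2 ^ card K * sqrt (card K))"
    by (intro mult_right_mono gauss_first_moment(2) \<open>0 < \<sigma>\<close>) simp
  finally have "(\<Sum>S\<in>Pow K. I S) \<le> real (card (Pow K)) * (sqrt (card K) * (real DIM('a) * \<sigma>))"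
    using K by (simp add: card_Pow mult_ac)
  moreover have "0 \<le> I S" for S
    unfolding I_def by (intro integral_nonneg_AE AE_I2 mult_nonneg_nonneg gauss_nonneg) simp_all
  moreover have "0 < sqrt (card K) * (real DIM('a) * \<sigma>)"
    using K \<open>0 < \<sigma>\<close> by (simp add: card_gt_0_iff)
  ultimately show ?thesis
    using card_le_twice_average[of "Pow K" I] K by (simp add: card_Pow)
qed

section \<open>Assembling the packing and choosing the grid size\<close>

lemma card_grid: "card (UNIV \<rightarrow> {..<m} :: ('n::finite \<Rightarrow> nat) set) = m ^ CARD('n)"
  using card_PiE[of "UNIV :: 'n set" "\<lambda>_. {..<m}"] by (simp add: PiE_UNIV_domain)

text \<open>Each bump has total mass \<open>(sqrt (2 * pi) / (8 * m * d)) ^ d\<close>, of which at least 3/4 lies in its ball.\<close>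

lemma exists_barron_packing:
  fixes C :: real and m :: nat
  assumes "0 < C" "0 < m"
  defines "n \<equiv> m ^ CARD('n)"
  defines "\<kappa> \<equiv> min C 1 / (256 * real CARD('n) ^ 3) * (sqrt (2 * pi) / (8 * real CARD('n))) ^ CARD('n)"
  shows "\<exists>P :: (real ^ 'n \<Rightarrow> real) set. P \<subseteq> barron C \<and> finite P \<and> (40 / 33) ^ n \<le> 2 * real (card P)
    \<and> (\<forall>f\<in>P. \<forall>g\<in>P. f \<noteq> g \<longrightarrow> \<kappa> / (real m * sqrt (real n)) < L1_dist f g)"
proof -
  define d where "d = real CARD('n)"
  have d: "1 \<le> d" by (simp add: d_def Suc_leI)
  let ?K = "UNIV \<rightarrow> {..<m} :: ('n \<Rightarrow> nat) set"
  have finK: "finite ?K" using finite_PiE[of "UNIV :: 'n set" "\<lambda>_. {..<m}"] by (simp add: PiE_UNIV_domain)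
  have cardK: "card ?K = n" by (simp add: card_grid n_def)
  have n: "0 < n" using \<open>0 < m\<close> by (simp add: n_def)
  then have neK: "?K \<noteq> {}" using cardK by (metis card.empty less_irrefl)
  \<comment> \<open>The bumps get standard deviation \<open>1 / (8 * m * d)\<close>. With radius
    \<open>1 / (4 * m)\<close> the Chebyshev defect is then \<open>1 / (4 * d)\<close>, hence at
    most \<open>1 / 4\<close>.\<close>
  define \<sigma> where "\<sigma> = 8 * real m * d"
  have \<sigma>: "0 < \<sigma>" using d \<open>0 < m\<close> by (simp add: \<sigma>_def)
  define z where "z k = (grid_point m (1 / 4) k :: real ^ 'n)" for k
  define I where "I S = (\<integral>\<eta>. norm \<eta> * gauss \<sigma> \<eta> * cmod (\<Sum>k\<in>?K. sgn_of S k *\<^sub>R exp (\<i> * complex_of_real (- z k \<bullet> \<eta>))) \<partial>lborel)" for S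
  define G where "G = {S \<in> Pow ?K. I S \<le> 2 * (sqrt n * (d * \<sigma>))}"
  have "2 ^ n \<le> 2 * card G"
    using many_good_signs[OF \<sigma> finK neK, of z] by (simp add: G_def I_def cardK d_def)
  then have cardG: "2 ^ n \<le> 2 * real (card G)"
    by (metis of_nat_le_iff of_nat_mult of_nat_numeral of_nat_power)
  obtain P where P: "P \<subseteq> G" and sep: "\<And>S T. S \<in> P \<Longrightarrow> T \<in> P \<Longrightarrow> S \<noteq> T \<Longrightarrow> n < 8 * card (sym_diff S T)"
    and cardP: "real (card G) \<le> real (card P) * (33 / 20) ^ n"
    using exists_separated_family[OF finK, of G] unfolding cardK by (auto simp: G_def)
  \<comment> \<open>The largest amplitude for which the moment bound defining \<open>G\<close>
    yields the hypothesis of \<open>bump_sum_in_barron\<close>.\<close>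
  define \<beta> where "\<beta> = min C 1 / (4 * d * (sqrt n * (d * \<sigma>)))"
  have \<beta>: "0 < \<beta>" using \<open>0 < C\<close> d n \<sigma> by (simp add: \<beta>_def)
  define \<phi> where "\<phi> k x = exp (- (\<sigma>\<^sup>2 * (norm (x - z k))\<^sup>2) / 2)" for k x
  define f where "f S = (\<lambda>x\<in>unit_cube. min C 1 / 2 + (\<Sum>k\<in>?K. \<beta> * sgn_of S k * (\<phi> k x - \<phi> k 0)))" for S
  have f_barron: "f S \<in> barron C" if "S \<in> P" for S
  proof -
    have "\<beta> * I S \<le> \<beta> * (2 * (sqrt n * (d * \<sigma>)))"
      using that P \<beta> by (intro mult_left_mono) (auto simp: G_def)
    also have "\<dots> = min C 1 / (2 * d)" using d n \<sigma> by (simp add: \<beta>_def field_simps)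
    finally show ?thesis
      using bump_sum_in_barron[OF \<open>0 < C\<close> \<sigma> less_imp_le[OF \<beta>] finK, of "sgn_of S" z]
      by (simp add: f_def \<phi>_def I_def d_def)
  qed
  define T where "T = (sqrt (2 * pi) / \<sigma>) ^ CARD('n)"
  have T: "0 < T" using \<sigma> by (simp add: T_def)
  define r where "r = 1 / (4 * real m)"
  have r: "0 < r" using \<open>0 < m\<close> by (simp add: r_def)
  have \<phi>_gauss: "\<phi> k x = T * gauss (1 / \<sigma>) (x - z k)" for k x
    using \<sigma> by (simp add: gauss_eq \<phi>_def T_def power_divide field_simps)
  have conc: "3 / 4 \<le> 1 - real DIM(real ^ 'n) * (1 / \<sigma>)\<^sup>2 / r\<^sup>2"
  proof -
    have "real DIM(real ^ 'n) * (1 / \<sigma>)\<^sup>2 / r\<^sup>2 = 1 / (4 * d)"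
      using d \<open>0 < m\<close> by (simp add: \<sigma>_def r_def d_def[symmetric] field_simps power2_eq_square)
    also have "\<dots> \<le> 1 / 4" using d by (simp add: field_simps)
    finally show ?thesis by simp
  qed
  have \<phi>_props: "integrable lborel (\<phi> k)" "0 \<le> \<phi> k x" "(\<integral>x. \<phi> k x \<partial>lborel) = T"
    "3 / 4 * T \<le> (\<integral>x. indicator (ball (z k) r) x * \<phi> k x \<partial>lborel)" for k x
  proof -
    note c = gauss_concentration[of "1 / \<sigma>" r "z k"]
    have \<phi>k: "\<phi> k = (\<lambda>x. T * gauss (1 / \<sigma>) (x - z k))" using \<phi>_gauss by blast
    show "integrable lborel (\<phi> k)" "(\<integral>x. \<phi> k x \<partial>lborel) = T"
      using c(1,2) \<sigma> r by (simp_all add: \<phi>k)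
    show "0 \<le> \<phi> k x" by (simp add: \<phi>_def)
    have "T * (3 / 4) \<le> T * (\<integral>x. indicator (ball (z k) r) x * gauss (1 / \<sigma>) (x - z k) \<partial>lborel)"
      using order_trans[OF conc c(3)] \<sigma> r T by (intro mult_left_mono) auto
    also have "\<dots> = (\<integral>x. indicator (ball (z k) r) x * \<phi> k x \<partial>lborel)"
      by (simp add: \<phi>k mult.left_commute)
    finally show "3 / 4 * T \<le> (\<integral>x. indicator (ball (z k) r) x * \<phi> k x \<partial>lborel)" by simp
  qed
  have dist: "\<kappa> / (real m * sqrt (real n)) < L1_dist (f S) (f S')" if S: "S \<in> P" "S' \<in> P" "S \<noteq> S'" for S S'
  proof -
    \<comment> \<open>Half the difference of the signs, nonzero exactly where the patterns differ;
      this is the origin of the factor \<open>2 * \<beta>\<close>.\<close>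
    define s where "s k = (sgn_of S k - sgn_of S' k) / 2" for k
    have s: "s k \<in> {- 1, 0, 1}" for k by (simp add: s_def sgn_of_def)
    then have "\<bar>s k\<bar> \<le> 1" for k by (metis abs_minus_cancel abs_one abs_zero insertE order_refl singletonD zero_le_one)
    then obtain w :: "real ^ 'n \<Rightarrow> real" where w: "integrable lborel w" "(\<integral>x. w x \<partial>lborel) = 0" "\<And>x. \<bar>w x\<bar> \<le> 1"
      "\<And>x. x \<notin> unit_cube \<Longrightarrow> w x = 0" "\<And>k x. k \<in> ?K \<Longrightarrow> x \<in> ball (z k) r \<Longrightarrow> w x = s k"
      using exists_sign_test_function[OF \<open>0 < m\<close>, of s] unfolding z_def r_def by metis
    have sgn_S: "sgn_of S k = sgn_of S' k + 2 * s k" for k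
      by (simp add: s_def diff_divide_distrib)
    have "\<beta> * T * real (card {k \<in> ?K. s k \<noteq> 0}) \<le> (LINT x:unit_cube|lborel. \<bar>f S x - f S' x\<bar>)"
    proof (rule L1_lower_bound_bumps[OF finK less_imp_le[OF \<beta>] \<phi>_props _ w s])
      show "f S x - f S' x = - (\<Sum>k\<in>?K. 2 * \<beta> * s k * \<phi> k 0) + (\<Sum>k\<in>?K. 2 * \<beta> * s k * \<phi> k x)"
        if "x \<in> unit_cube" for x
        using that by (simp add: f_def sgn_S sum_subtractf[symmetric] sum_negf[symmetric] sum.distrib[symmetric] algebra_simps)
      show "set_integrable lborel unit_cube (\<lambda>x. f S x - f S' x)"
        using f_barron S by (intro set_integral_diff set_integrable_barron[of _ C]) auto
    qed auto
    moreover have "{k \<in> ?K. s k \<noteq> 0} = sym_diff S S'"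
      using S P by (auto simp: s_def sgn_of_def G_def)
    moreover have "real n / 8 < real (card (sym_diff S S'))" using sep[OF S] by linarith
    then have "\<beta> * T * (real n / 8) < \<beta> * T * real (card (sym_diff S S'))"
      using \<beta> T by simp
    ultimately have lower: "\<beta> * T * (real n / 8) < L1_dist (f S) (f S')" by (simp add: L1_dist_def)
    \<comment> \<open>The mass of one bump contains \<open>1 / m ^ d = 1 / n\<close>, which cancels
      against the more than \<open>n / 8\<close> differing cells.\<close>
    have "T = (sqrt (2 * pi) / (8 * d)) ^ CARD('n) / real n"
      by (simp add: T_def n_def \<sigma>_def power_divide power_mult_distrib)
    moreover have "\<beta> = min C 1 / (32 * d ^ 3) / (real m * sqrt n)"
      by (simp add: \<beta>_def \<sigma>_def power3_eq_cube mult_ac)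
    ultimately have "\<kappa> / (real m * sqrt (real n)) = \<beta> * T * (real n / 8)"
      using n by (simp add: \<kappa>_def d_def[symmetric])
    with lower show ?thesis by (simp only:)
  qed
  have inj: "inj_on f P"
  proof (rule inj_onI, rule ccontr)
    fix S S' assume "S \<in> P" "S' \<in> P" "f S = f S'" "S \<noteq> S'"
    moreover have "0 \<le> \<kappa> / (real m * sqrt (real n))" using \<open>0 < C\<close> by (simp add: \<kappa>_def)
    ultimately show False using dist[of S S'] by (simp add: L1_dist_def)
  qed
  \<comment> \<open>Half of the sign patterns are good and each ball holds at most
    \<open>(33 / 20) ^ n\<close> of them; the quotient of the bases is
    \<open>40 / 33\<close>.\<close>
  have "2 ^ n \<le> 2 * real (card P) * (33 / 20) ^ n" using cardG cardP by linarith
  then have "2 ^ n / (33 / 20) ^ n \<le> 2 * real (card P)" by (simp add: divide_le_eq)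
  then have "(40 / 33) ^ n \<le> 2 * real (card (f ` P))"
    using card_image[OF inj] by (simp add: power_divide[symmetric])
  moreover have "finite (f ` P)"
  proof (rule finite_imageI, rule finite_subset)
    show "P \<subseteq> Pow ?K" using P by (auto simp: G_def)
  qed (use finK in simp)
  ultimately show ?thesis
    using f_barron dist by (intro exI[of _ "f ` P"]) auto
qed

text \<open>The grid size is the integer part of \<open>(\<kappa> / \<epsilon>) powr p\<close>,
  where \<open>p * (1 + d / 2) = 1\<close>. This is the finest grid with
  \<open>m powr (1 + d / 2) \<le> \<kappa> / \<epsilon>\<close>, that is, with separation still at
  least \<open>\<epsilon>\<close>.\<close>

lemma packing_entropy_barron_ge:
  fixes C :: real
  assumes "0 < C"
  shows "\<exists>\<epsilon>0 > 0. \<exists>C0 > 0. \<forall>\<epsilon> \<in> {0<..\<epsilon>0}.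
    ereal (C0 * \<epsilon> powr (- (2 * real CARD('n) / (2 + real CARD('n)))))
      \<le> packing_entropy (barron C :: (real ^ 'n \<Rightarrow> real) set) L1_dist \<epsilon>"
proof -
  define d where "d = real CARD('n)"
  have d: "1 \<le> d" by (simp add: d_def Suc_leI)
  define \<kappa> where "\<kappa> = min C 1 / (256 * real CARD('n) ^ 3) * (sqrt (2 * pi) / (8 * real CARD('n))) ^ CARD('n)"
  have \<kappa>: "0 < \<kappa>" using \<open>0 < C\<close> by (simp add: \<kappa>_def)
  define L where "L = ln (40 / 33 :: real)"
  have L: "0 < L" by (simp add: L_def)
  \<comment> \<open>A lower bound for \<open>y\<close> that makes \<open>m\<close> positive and lets
    half of \<open>n * L\<close> absorb the \<open>ln 2\<close> lost by keeping only half of the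
    sign patterns.\<close>
  define M where "M = max 1 (4 * ln 2 / L)"
  have M: "1 \<le> M" "4 * ln 2 / L \<le> M" by (auto simp: M_def)
  define p where "p = 2 / (2 + d)"
  have p: "0 < p" "p * (1 + d / 2) = 1" using d by (simp_all add: p_def field_simps)
  define \<epsilon>0 where "\<epsilon>0 = \<kappa> * M powr (- (1 / p))"
  \<comment> \<open>The factor \<open>L / 2\<close> remains after absorbing \<open>ln 2\<close>; the
    power of \<open>1 / 2\<close> is the loss from rounding \<open>y\<close> down to
    \<open>m\<close>.\<close>
  define C0 where "C0 = L / 2 * (1 / 2) powr d * \<kappa> powr (p * d)"
  have "ereal (C0 * \<epsilon> powr (- (2 * real CARD('n) / (2 + real CARD('n)))))
      \<le> packing_entropy (barron C :: (real ^ 'n \<Rightarrow> real) set) L1_dist \<epsilon>" if \<epsilon>: "\<epsilon> \<in> {0<..\<epsilon>0}" for \<epsilon>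
  proof -
    have \<epsilon>0: "0 < \<epsilon>" "\<epsilon> \<le> \<epsilon>0" using \<epsilon> by auto
    define y where "y = (\<kappa> / \<epsilon>) powr p"
    have "M powr (1 / p) \<le> \<kappa> / \<epsilon>"
      using \<epsilon>0 M by (simp add: \<epsilon>0_def powr_minus field_simps)
    then have "(M powr (1 / p)) powr p \<le> y"
      unfolding y_def using p by (intro powr_mono2) auto
    then have y: "M \<le> y" using p M by (simp add: powr_powr)
    define m where "m = nat \<lfloor>y\<rfloor>"
    have m: "real m \<le> y" "y / 2 \<le> real m" "0 < m"
    proof -
      \<comment> \<open>Since the floor is at least 1, \<open>y\<close> is below the floor plus 1
        and hence below twice the floor.\<close>
      have "1 \<le> \<lfloor>y\<rfloor>" using y M by simp
      then have "real m = of_int \<lfloor>y\<rfloor>" "1 \<le> real_of_int \<lfloor>y\<rfloor>" by (simp_all add: m_def)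
      then show "real m \<le> y" "y / 2 \<le> real m" "0 < m"
        using floor_correct[of y] by linarith+
    qed
    define n where "n = m ^ CARD('n)"
    have n: "real n = real m powr d" using m by (simp add: n_def d_def powr_realpow)
    have "real m * sqrt (real n) = real m powr (1 + d / 2)"
      using m by (simp add: n powr_add powr_half_sqrt[symmetric] powr_powr)
    also have "\<dots> \<le> y powr (1 + d / 2)" using m d by (intro powr_mono2) auto
    also have "\<dots> = \<kappa> / \<epsilon>" using \<kappa> \<epsilon>0 p by (simp add: y_def powr_powr)
    finally have sep: "\<epsilon> \<le> \<kappa> / (real m * sqrt (real n))"
      using \<epsilon>0 m n by (simp add: field_simps)
    obtain P :: "(real ^ 'n \<Rightarrow> real) set" where P: "P \<subseteq> barron C" "finite P" "(40 / 33) ^ n \<le> 2 * real (card P)"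
      "\<And>f g. f \<in> P \<Longrightarrow> g \<in> P \<Longrightarrow> f \<noteq> g \<Longrightarrow> \<kappa> / (real m * sqrt (real n)) < L1_dist f g"
      using exists_barron_packing[OF \<open>0 < C\<close> m(3), where 'n = 'n] unfolding \<kappa>_def n_def by blast
    have "0 < (40 / 33 :: real) ^ n" by simp
    then have card: "0 < real (card P)" using P(3) by linarith
    have "real n * L = ln ((40 / 33) ^ n)" by (simp add: L_def ln_realpow)
    also have "\<dots> \<le> ln (2 * real (card P))" using P(3) by (intro ln_mono) auto
    also have "\<dots> = ln 2 + ln (real (card P))" using card by (simp add: ln_mult)
    finally have "real n * L - ln 2 \<le> ln (real (card P))" by simp
    moreover have "ln 2 \<le> real n * L / 2"
    proof -
      have "2 * ln 2 / L \<le> real m" using m(2) y M(2) by simp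
      also have "\<dots> \<le> real n"
        using m(3) self_le_power[of "real m" "CARD('n)"] by (simp add: n_def)
      finally show ?thesis using L by (simp add: field_simps)
    qed
    ultimately have "L / 2 * real n \<le> ln (real (card P))" by (simp add: algebra_simps)
    moreover have "C0 * \<epsilon> powr (- (p * d)) \<le> L / 2 * real n"
    proof -
      have "C0 * \<epsilon> powr (- (p * d)) = L / 2 * (y / 2) powr d"
        using \<kappa> \<epsilon>0 by (simp add: C0_def y_def powr_divide powr_powr powr_minus_divide powr_mult field_simps)
      also have "\<dots> \<le> L / 2 * real n"
        unfolding n using L m(2) y M d by (intro mult_left_mono powr_mono2) auto
      finally show ?thesis .
    qed
    ultimately have "ereal (C0 * \<epsilon> powr (- (p * d))) \<le> ereal (ln (real (card P)))" by simp
    also have "\<dots> \<le> packing_entropy (barron C :: (real ^ 'n \<Rightarrow> real) set) L1_dist \<epsilon>"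
      unfolding packing_entropy_def
    proof (rule SUP_upper)
      show "P \<in> {N. packing_set (barron C :: (real ^ 'n \<Rightarrow> real) set) L1_dist \<epsilon> N \<and> finite N \<and> N \<noteq> {}}"
        using P sep card by (force simp: packing_set_def)
    qed
    finally show ?thesis by (simp add: p_def d_def)
  qed
  moreover have "0 < \<epsilon>0" "0 < C0" using \<kappa> M L by (simp_all add: \<epsilon>0_def C0_def)
  ultimately show ?thesis by blast
qed

theorem proposition4p6:
  fixes C :: real
  assumes "C > 0"
  shows "\<exists>\<epsilon>0 > 0. \<exists>C0 > 0. \<forall>\<epsilon> \<in> {0<..\<epsilon>0}.
      packing_entropy (general_barron C :: (real ^ 'n \<Rightarrow> real) set) L1_dist \<epsilon>
        \<ge> packing_entropy (general_barron_star C :: (real ^ 'n \<Rightarrow> real) set) L1_dist \<epsilon>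
    \<and> packing_entropy (general_barron_star C :: (real ^ 'n \<Rightarrow> real) set) L1_dist \<epsilon>
        \<ge> packing_entropy (barron C :: (real ^ 'n \<Rightarrow> real) set) L1_dist \<epsilon>
    \<and> packing_entropy (barron C :: (real ^ 'n \<Rightarrow> real) set) L1_dist \<epsilon>
        \<ge> ereal (C0 * \<epsilon> powr (- (2 * real CARD('n) / (2 + real CARD('n)))))
    \<and> C0 * \<epsilon> powr (- (2 * real CARD('n) / (2 + real CARD('n))))
        = C0 * \<epsilon> powr (- (1 / (1 / 2 + 1 / real CARD('n))))"
proof -
  have sub: "general_barron_star C \<subseteq> (general_barron C :: (real ^ 'n \<Rightarrow> real) set)"
    by (auto simp: general_barron_star_def)
  have "2 * real CARD('n) / (2 + real CARD('n)) = 1 / (1 / 2 + 1 / real CARD('n))"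
    by (simp add: field_simps)
  then show ?thesis
    using packing_entropy_barron_ge[OF assms, where 'n = 'n]
      packing_entropy_mono[OF sub] packing_entropy_barron_le[OF assms, where 'n = 'n] by fastforce
qed

end
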